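(* For any finitary abelian category $\mathscr A$ one has $$\Delta(\mathrm{Exp}_{\mathscr A})=\mathrm{Exp}_{\mathscr A}\otimes\mathrm{Exp}_{\mathscr A},$$ where $\mathrm{Exp}_{\mathscr A}=\sum_{[A]\in\mathrm{Iso}\,\mathscr A}[A]$ and $\Delta:H_{\mathscr A}\to H_{\mathscr A}\widehat\otimes H_{\mathscr A}$ is the (not necessarily coassociative) coproduct $$\Delta([C])=\sum_{[A],[B]\in\mathrm{Iso}\,\mathscr A}\frac{|\mathrm{Hom}_{\mathscr A}(A,B)|}{|\mathrm{Ext}^1_{\mathscr A}(A,B)|}\,F^{A,B}_C\cdot[A]\otimes[B],\qquad F^{A,B}_C=\frac{|\mathrm{Aut}_{\mathscr A}(A)|\,|\mathrm{Aut}_{\mathscr A}(B)|}{|\mathrm{Aut}_{\mathscr A}(C)|}\,F_{A,B}^C,$$ extended to (possibly infinite) formal sums.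
   Context: An (essentially small) abelian category $\mathscr A$ is finitary if $\mathrm{Hom}_{\mathscr A}(M,N)$ and $\mathrm{Ext}^1_{\mathscr A}(M,N)$ are finite sets for all objects. $\mathrm{Iso}\,\mathscr A$ is the set of isomorphism classes of objects and $H_{\mathscr A}$ is the Hall algebra: the $\mathbb Q$-vector space with basis $\mathrm{Iso}\,\mathscr A$ and multiplication $[M][N]=\sum_{[K]}F_{M,N}^K[K]$, where $F_{M,N}^K$ is the number of subobjects $U\subset K$ with $U\cong N$ and $K/U\cong M$. $\mathrm{Exp}_{\mathscr A}$ lies in the completion of $H_{\mathscr A}$ with respect to the $K_0(\mathscr A)$-grading, and $H_{\mathscr A}\widehat\otimes H_{\mathscr A}$ consists of formal, possibly infinite, linear combinations of the elements $[A]\otimes[B]$. *)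

theory Defs
  imports Complex_Main "HOL-Algebra.Group" "HOL-Library.Groups_Big_Fun"
begin

section \<open>Abelian categories\<close>

text \<open>Every arrow has a unique source and target, so hom-sets of different pairs of objects are
  disjoint. The composite \<open>g \<cdot> f\<close> means first \<open>f\<close>, then \<open>g\<close>.\<close>

record ('o, 'm) cat =
  objs :: "'o set"
  arrs :: "'m set"
  src :: "'m \<Rightarrow> 'o"
  tgt :: "'m \<Rightarrow> 'o"
  ident :: "'o \<Rightarrow> 'm"
  cmp :: "'m \<Rightarrow> 'm \<Rightarrow> 'm" (infixl "\<cdot>\<index>" 70)

record ('o, 'm) preadd_cat = "('o, 'm) cat" +
  zero_arr :: "'o \<Rightarrow> 'o \<Rightarrow> 'm"
  add_arr :: "'m \<Rightarrow> 'm \<Rightarrow> 'm" (infixl "\<boxplus>\<index>" 65)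

definition Hom :: "('o, 'm, 'x) cat_scheme \<Rightarrow> 'o \<Rightarrow> 'o \<Rightarrow> 'm set" where
  "Hom C A B = {f \<in> arrs C. src C f = A \<and> tgt C f = B}"

definition Hom_group :: "('o, 'm, 'x) preadd_cat_scheme \<Rightarrow> 'o \<Rightarrow> 'o \<Rightarrow> 'm monoid" where
  "Hom_group C A B = \<lparr>carrier = Hom C A B, mult = add_arr C, one = zero_arr C A B\<rparr>"

locale category =
  fixes C :: "('o, 'm, 'x) cat_scheme" (structure)
  assumes src_closed: "f \<in> arrs C \<Longrightarrow> src C f \<in> objs C"
    and tgt_closed: "f \<in> arrs C \<Longrightarrow> tgt C f \<in> objs C"
    and ident_closed: "A \<in> objs C \<Longrightarrow> ident C A \<in> Hom C A A"
    and cmp_closed: "f \<in> Hom C A B \<Longrightarrow> g \<in> Hom C B D \<Longrightarrow> g \<cdot> f \<in> Hom C A D"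
    and cmp_ident_right: "f \<in> Hom C A B \<Longrightarrow> f \<cdot> ident C A = f"
    and cmp_ident_left: "f \<in> Hom C A B \<Longrightarrow> ident C B \<cdot> f = f"
    and cmp_assoc: "f \<in> Hom C A B \<Longrightarrow> g \<in> Hom C B D \<Longrightarrow> h \<in> Hom C D E \<Longrightarrow>
      h \<cdot> (g \<cdot> f) = (h \<cdot> g) \<cdot> f"

locale preadditive_category = category C
  for C :: "('o, 'm, 'x) preadd_cat_scheme" (structure) +
  assumes Hom_comm_group: "A \<in> objs C \<Longrightarrow> B \<in> objs C \<Longrightarrow> comm_group (Hom_group C A B)"
    and cmp_add_right: "f \<in> Hom C A B \<Longrightarrow> f' \<in> Hom C A B \<Longrightarrow> g \<in> Hom C B D \<Longrightarrow>
      g \<cdot> (f \<boxplus> f') = (g \<cdot> f) \<boxplus> (g \<cdot> f')"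
    and cmp_add_left: "f \<in> Hom C A B \<Longrightarrow> g \<in> Hom C B D \<Longrightarrow> g' \<in> Hom C B D \<Longrightarrow>
      (g \<boxplus> g') \<cdot> f = (g \<cdot> f) \<boxplus> (g' \<cdot> f)"

definition iso_arr :: "('o, 'm, 'x) cat_scheme \<Rightarrow> 'm \<Rightarrow> bool" where
  "iso_arr C f \<longleftrightarrow> f \<in> arrs C \<and> (\<exists>g \<in> Hom C (tgt C f) (src C f).
     cmp C g f = ident C (src C f) \<and> cmp C f g = ident C (tgt C f))"

definition mono_arr :: "('o, 'm, 'x) cat_scheme \<Rightarrow> 'm \<Rightarrow> bool" where
  "mono_arr C m \<longleftrightarrow> m \<in> arrs C \<and> (\<forall>A \<in> objs C. \<forall>f \<in> Hom C A (src C m). \<forall>g \<in> Hom C A (src C m).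
     cmp C m f = cmp C m g \<longrightarrow> f = g)"

definition epi_arr :: "('o, 'm, 'x) cat_scheme \<Rightarrow> 'm \<Rightarrow> bool" where
  "epi_arr C e \<longleftrightarrow> e \<in> arrs C \<and> (\<forall>A \<in> objs C. \<forall>f \<in> Hom C (tgt C e) A. \<forall>g \<in> Hom C (tgt C e) A.
     cmp C f e = cmp C g e \<longrightarrow> f = g)"

definition zero_obj :: "('o, 'm, 'x) cat_scheme \<Rightarrow> 'o \<Rightarrow> bool" where
  "zero_obj C Z \<longleftrightarrow> Z \<in> objs C \<and>
     (\<forall>A \<in> objs C. (\<exists>!f. f \<in> Hom C A Z) \<and> (\<exists>!f. f \<in> Hom C Z A))"

definition is_biproduct ::
  "('o, 'm, 'x) preadd_cat_scheme \<Rightarrow> 'o \<Rightarrow> 'o \<Rightarrow> 'o \<Rightarrow> 'm \<Rightarrow> 'm \<Rightarrow> 'm \<Rightarrow> 'm \<Rightarrow> bool" where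
  "is_biproduct C A B P i j p q \<longleftrightarrow>
     P \<in> objs C \<and> i \<in> Hom C A P \<and> j \<in> Hom C B P \<and> p \<in> Hom C P A \<and> q \<in> Hom C P B \<and>
     cmp C p i = ident C A \<and> cmp C q j = ident C B \<and>
     cmp C p j = zero_arr C B A \<and> cmp C q i = zero_arr C A B \<and>
     add_arr C (cmp C i p) (cmp C j q) = ident C P"

definition is_kernel :: "('o, 'm, 'x) preadd_cat_scheme \<Rightarrow> 'm \<Rightarrow> 'm \<Rightarrow> bool" where
  "is_kernel C k f \<longleftrightarrow> k \<in> arrs C \<and> f \<in> arrs C \<and> tgt C k = src C f \<and>
     cmp C f k = zero_arr C (src C k) (tgt C f) \<and>
     (\<forall>A \<in> objs C. \<forall>h \<in> Hom C A (src C f). cmp C f h = zero_arr C A (tgt C f) \<longrightarrow>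
        (\<exists>!u. u \<in> Hom C A (src C k) \<and> cmp C k u = h))"

definition is_cokernel :: "('o, 'm, 'x) preadd_cat_scheme \<Rightarrow> 'm \<Rightarrow> 'm \<Rightarrow> bool" where
  "is_cokernel C c f \<longleftrightarrow> c \<in> arrs C \<and> f \<in> arrs C \<and> src C c = tgt C f \<and>
     cmp C c f = zero_arr C (src C f) (tgt C c) \<and>
     (\<forall>A \<in> objs C. \<forall>h \<in> Hom C (tgt C f) A. cmp C h f = zero_arr C (src C f) A \<longrightarrow>
        (\<exists>!u. u \<in> Hom C (tgt C c) A \<and> cmp C u c = h))"

locale abelian_category = preadditive_category C
  for C :: "('o, 'm, 'x) preadd_cat_scheme" (structure) +
  assumes zero_obj_exists: "\<exists>Z. zero_obj C Z"
    and biproduct_exists: "A \<in> objs C \<Longrightarrow> B \<in> objs C \<Longrightarrow> \<exists>P i j p q. is_biproduct C A B P i j p q"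
    and kernel_exists: "f \<in> arrs C \<Longrightarrow> \<exists>k. is_kernel C k f"
    and cokernel_exists: "f \<in> arrs C \<Longrightarrow> \<exists>c. is_cokernel C c f"
    and mono_normal: "mono_arr C m \<Longrightarrow> \<exists>f. is_kernel C m f"
    and epi_normal: "epi_arr C e \<Longrightarrow> \<exists>f. is_cokernel C e f"

section \<open>Yoneda extensions and finitary categories\<close>

text \<open>An extension of \<open>A\<close> by \<open>B\<close> is a short exact sequence \<open>0 \<rightarrow> B \<rightarrow> X \<rightarrow> A \<rightarrow> 0\<close>, given by its two
  inner arrows. Two of them are equivalent if there is an isomorphism of the middle terms
  compatible with the identities of \<open>A\<close> and \<open>B\<close>.\<close>

definition short_exact :: "('o, 'm, 'x) preadd_cat_scheme \<Rightarrow> 'm \<Rightarrow> 'm \<Rightarrow> bool" where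
  "short_exact C f g \<longleftrightarrow> is_kernel C f g \<and> is_cokernel C g f"

definition extensions :: "('o, 'm, 'x) preadd_cat_scheme \<Rightarrow> 'o \<Rightarrow> 'o \<Rightarrow> ('m \<times> 'm) set" where
  "extensions C A B = {(f, g). short_exact C f g \<and> src C f = B \<and> tgt C g = A}"

definition ext_rel :: "('o, 'm, 'x) preadd_cat_scheme \<Rightarrow> 'o \<Rightarrow> 'o \<Rightarrow> (('m \<times> 'm) \<times> ('m \<times> 'm)) set" where
  "ext_rel C A B = {((f, g), (f', g')).
     (f, g) \<in> extensions C A B \<and> (f', g') \<in> extensions C A B \<and>
     (\<exists>h \<in> Hom C (tgt C f) (tgt C f'). iso_arr C h \<and> cmp C h f = f' \<and> cmp C g' h = g)}"

definition Ext1 :: "('o, 'm, 'x) preadd_cat_scheme \<Rightarrow> 'o \<Rightarrow> 'o \<Rightarrow> ('m \<times> 'm) set set" where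
  "Ext1 C A B = extensions C A B // ext_rel C A B"

locale finitary_abelian_category = abelian_category C
  for C :: "('o, 'm, 'x) preadd_cat_scheme" (structure) +
  assumes finite_Hom: "A \<in> objs C \<Longrightarrow> B \<in> objs C \<Longrightarrow> finite (Hom C A B)"
    and finite_Ext1: "A \<in> objs C \<Longrightarrow> B \<in> objs C \<Longrightarrow> finite (Ext1 C A B)"

section \<open>Isomorphism classes, subobjects and Hall numbers\<close>

definition isomorphic :: "('o, 'm, 'x) cat_scheme \<Rightarrow> 'o \<Rightarrow> 'o \<Rightarrow> bool" where
  "isomorphic C A B \<longleftrightarrow> (\<exists>f \<in> Hom C A B. iso_arr C f)"

definition Iso :: "('o, 'm, 'x) cat_scheme \<Rightarrow> 'o set set" where
  "Iso C = objs C // {(A, B). A \<in> objs C \<and> B \<in> objs C \<and> isomorphic C A B}"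

definition Aut :: "('o, 'm, 'x) cat_scheme \<Rightarrow> 'o \<Rightarrow> 'm set" where
  "Aut C A = {f \<in> Hom C A A. iso_arr C f}"

definition subobjects :: "('o, 'm, 'x) cat_scheme \<Rightarrow> 'o \<Rightarrow> 'm set set" where
  "subobjects C K = {u. mono_arr C u \<and> tgt C u = K} //
     {(u, v). mono_arr C u \<and> tgt C u = K \<and> mono_arr C v \<and> tgt C v = K \<and>
        (\<exists>h \<in> Hom C (src C u) (src C v). iso_arr C h \<and> cmp C v h = u)}"

text \<open>\<open>hall_number C M N K\<close> is \<open>F\<^sub>M\<^sub>,\<^sub>N\<^sup>K\<close>: the sub is \<open>N\<close>, the quotient is \<open>M\<close>. The
  condition does not depend on the mono representing the subobject.\<close>

definition hall_number :: "('o, 'm, 'x) preadd_cat_scheme \<Rightarrow> 'o \<Rightarrow> 'o \<Rightarrow> 'o \<Rightarrow> nat" where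
  "hall_number C M N K = card {U \<in> subobjects C K. \<exists>u \<in> U. isomorphic C (src C u) N \<and>
     (\<exists>c. is_cokernel C c u \<and> isomorphic C (tgt C c) M)}"

definition dual_hall_number :: "('o, 'm, 'x) preadd_cat_scheme \<Rightarrow> 'o \<Rightarrow> 'o \<Rightarrow> 'o \<Rightarrow> rat" where
  "dual_hall_number C A B K =
     of_nat (card (Aut C A)) * of_nat (card (Aut C B)) / of_nat (card (Aut C K)) *
     of_nat (hall_number C A B K)"

definition comult_coeff :: "('o, 'm, 'x) preadd_cat_scheme \<Rightarrow> 'o \<Rightarrow> 'o \<Rightarrow> 'o \<Rightarrow> rat" where
  "comult_coeff C A B K =
     of_nat (card (Hom C A B)) / of_nat (card (Ext1 C A B)) * dual_hall_number C A B K"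

section \<open>Formal sums and the coproduct\<close>

text \<open>A formal, possibly infinite, rational linear combination of the symbols \<open>[A]\<close> is its
  coefficient function on \<open>Iso C\<close>, extended by \<open>0\<close> to all sets of objects; likewise for
  combinations of the symbols \<open>[A] \<otimes> [B]\<close>, on pairs of classes. The Hall algebra itself
  consists of the finitely supported ones.\<close>

definition hall_exp :: "('o, 'm, 'x) cat_scheme \<Rightarrow> 'o set \<Rightarrow> rat" where
  "hall_exp C = (\<lambda>c. if c \<in> Iso C then 1 else 0)"

definition hall_tensor :: "('o set \<Rightarrow> rat) \<Rightarrow> ('o set \<Rightarrow> rat) \<Rightarrow> 'o set \<times> 'o set \<Rightarrow> rat" where
  "hall_tensor f g = (\<lambda>(a, b). f a * g b)"

definition rep :: "'o set \<Rightarrow> 'o" where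
  "rep c = (SOME A. A \<in> c)"

text \<open>The coefficients below depend on the objects only up to isomorphism, so any
  representatives will do.\<close>

definition comult_basis :: "('o, 'm, 'x) preadd_cat_scheme \<Rightarrow> 'o set \<Rightarrow> 'o set \<times> 'o set \<Rightarrow> rat" where
  "comult_basis C c = (\<lambda>(a, b).
     if c \<in> Iso C \<and> a \<in> Iso C \<and> b \<in> Iso C then comult_coeff C (rep a) (rep b) (rep c) else 0)"

text \<open>\<open>Sum_any\<close> sums the nonzero terms and is \<open>0\<close> if there are infinitely many of them. For each
  pair \<open>(a, b)\<close> only finitely many middle terms \<open>c\<close> have a nonzero coefficient when \<open>C\<close> is
  finitary, because each of them carries an element of the finite \<open>Ext\<^sup>1\<close>, so that convention never
  takes effect there.\<close>

definition comult :: "('o, 'm, 'x) preadd_cat_scheme \<Rightarrow> ('o set \<Rightarrow> rat) \<Rightarrow> 'o set \<times> 'o set \<Rightarrow> rat" where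
  "comult C f = (\<lambda>x. Sum_any (\<lambda>c. f c * comult_basis C c x))"

end

theory Submission
  imports Defs
begin

text \<open>Fix \<open>A\<close>, \<open>B\<close>, \<open>K\<close> and let \<open>W\<close> be the set of short exact sequences \<open>0 \<rightarrow> B \<rightarrow> K \<rightarrow> A \<rightarrow> 0\<close>. Sending a
  sequence to the image of \<open>B\<close> has fibres that are torsors under \<open>Aut A \<times> Aut B\<close>, so
  \<open>|W| = |Aut A| |Aut B| F\<^sub>A\<^sub>,\<^sub>B\<^sup>K\<close>. On the other hand \<open>Aut K\<close> acts on \<open>W\<close>; its orbits are the classes in
  \<open>Ext\<^sup>1(A, B)\<close> with middle term \<open>K\<close>, and each stabiliser \<open>{1 + f \<phi> g | \<phi> \<in> Hom(A, B)}\<close> has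
  \<open>|Hom(A, B)|\<close> elements. Hence the coefficient of \<open>[A] \<otimes> [B]\<close> in \<open>\<Delta>([K])\<close> is the proportion of
  classes in \<open>Ext\<^sup>1(A, B)\<close> with middle term \<open>K\<close> (Riedtmann's formula), and these proportions add
  up to 1.\<close>

text \<open>Common shape of the three counts below: automorphisms of \<open>K\<close> fibred over an
  orbit, and short exact sequences fibred over extension classes and over subobjects. The fibres are
  given as a family instead of by a projection map, hence the explicit disjointness
  condition.\<close>

lemma card_disjoint_fibres:
  assumes "finite A" "finite I" "A = (\<Union>i\<in>I. T i)" "\<And>i. i \<in> I \<Longrightarrow> card (T i) = n"
    and "\<And>i j x. i \<in> I \<Longrightarrow> j \<in> I \<Longrightarrow> x \<in> T i \<Longrightarrow> x \<in> T j \<Longrightarrow> i = j"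
  shows "card A = n * card I"
proof -
  have "finite (T i)" if "i \<in> I" for i
    using assms(1,3) that by (metis UN_upper finite_subset)
  then have "card A = (\<Sum>i\<in>I. card (T i))"
    unfolding assms(3) using assms(2,5) by (intro card_UN_disjoint) blast+
  then show ?thesis
    using assms(4) by simp
qed

section \<open>Isomorphisms and short exact sequences\<close>

context category
begin

lemma Hom_iff: "f \<in> Hom C A B \<longleftrightarrow> f \<in> arrs C \<and> src C f = A \<and> tgt C f = B"
  by (simp add: Hom_def)

lemma cmp_arr:
  assumes "f \<in> arrs C" "g \<in> arrs C" "src C g = tgt C f"
  shows "g \<cdot> f \<in> arrs C" "src C (g \<cdot> f) = src C f" "tgt C (g \<cdot> f) = tgt C g"
  using cmp_closed[of f "src C f" "tgt C f" g "tgt C g"] assms by (auto simp: Hom_iff)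

lemma ident_arr:
  assumes "A \<in> objs C"
  shows "ident C A \<in> arrs C" "src C (ident C A) = A" "tgt C (ident C A) = A"
  using ident_closed[OF assms] by (auto simp: Hom_iff)

lemma cmp_assoc_arr:
  assumes "f \<in> arrs C" "g \<in> arrs C" "h \<in> arrs C" "src C g = tgt C f" "src C h = tgt C g"
  shows "(h \<cdot> g) \<cdot> f = h \<cdot> (g \<cdot> f)"
  using cmp_assoc[of f "src C f" "tgt C f" g "tgt C g" h "tgt C h"] assms by (auto simp: Hom_iff)

lemma ident_cmp:
  assumes "f \<in> arrs C"
  shows "tgt C f = A \<Longrightarrow> ident C A \<cdot> f = f" "src C f = A \<Longrightarrow> f \<cdot> ident C A = f"
  using cmp_ident_left[of f "src C f" "tgt C f"] cmp_ident_right[of f "src C f" "tgt C f"] assms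
  unfolding Hom_iff by metis+

text \<open>Hom-set membership is unfolded into sources and targets, and composites are reassociated
  to the right. This lets the simplifier discharge the composability conditions that the total
  operation \<open>cmp\<close> does not enforce.\<close>

lemmas cat_simps = Hom_iff cmp_arr ident_arr cmp_assoc_arr ident_cmp src_closed tgt_closed

text \<open>Unlike \<open>iso_arr\<close>, this keeps the inverse as an argument, so that equations
  can be moved across an isomorphism without choosing an inverse again.\<close>

definition inverse_arrs :: "'m \<Rightarrow> 'm \<Rightarrow> bool" where
  "inverse_arrs h k \<longleftrightarrow> h \<in> arrs C \<and> k \<in> Hom C (tgt C h) (src C h) \<and>
     k \<cdot> h = ident C (src C h) \<and> h \<cdot> k = ident C (tgt C h)"

lemma iso_arr_iff: "iso_arr C h \<longleftrightarrow> (\<exists>k. inverse_arrs h k)"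
  by (auto simp: iso_arr_def inverse_arrs_def)

lemma inverse_arrs_sym: "inverse_arrs h k \<Longrightarrow> inverse_arrs k h"
  by (auto simp: inverse_arrs_def Hom_iff)

lemma inverse_arrsD:
  assumes "inverse_arrs h k"
  shows "h \<in> arrs C" "k \<in> arrs C" "src C k = tgt C h" "tgt C k = src C h"
    "k \<cdot> h = ident C (src C h)" "h \<cdot> k = ident C (tgt C h)"
    "x \<in> arrs C \<Longrightarrow> tgt C x = src C h \<Longrightarrow> k \<cdot> (h \<cdot> x) = x"
    "x \<in> arrs C \<Longrightarrow> tgt C x = tgt C h \<Longrightarrow> h \<cdot> (k \<cdot> x) = x"
proof -
  show *: "h \<in> arrs C" "k \<in> arrs C" "src C k = tgt C h" "tgt C k = src C h"
    "k \<cdot> h = ident C (src C h)" "h \<cdot> k = ident C (tgt C h)"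
    using assms by (auto simp: inverse_arrs_def Hom_iff)
  show "x \<in> arrs C \<Longrightarrow> tgt C x = src C h \<Longrightarrow> k \<cdot> (h \<cdot> x) = x"
    using cmp_assoc_arr[of x h k] * ident_cmp(1) by metis
  show "x \<in> arrs C \<Longrightarrow> tgt C x = tgt C h \<Longrightarrow> h \<cdot> (k \<cdot> x) = x"
    using cmp_assoc_arr[of x k h] * ident_cmp(1) by metis
qed

lemma inverse_arrs_cancel:
  assumes "inverse_arrs h k"
  shows "f \<in> arrs C \<Longrightarrow> tgt C f = src C h \<Longrightarrow> h \<cdot> f = f' \<Longrightarrow> k \<cdot> f' = f"
    and "g' \<in> arrs C \<Longrightarrow> src C g' = tgt C h \<Longrightarrow> g' \<cdot> h = g \<Longrightarrow> g \<cdot> k = g'"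
  using inverse_arrsD[OF assms] by (auto simp: cat_simps)

lemma inverse_arrs_ident: "A \<in> objs C \<Longrightarrow> inverse_arrs (ident C A) (ident C A)"
  by (auto simp: inverse_arrs_def cat_simps)

lemma inverse_arrs_cmp:
  assumes "inverse_arrs h h'" "inverse_arrs k k'" "src C k = tgt C h"
  shows "inverse_arrs (k \<cdot> h) (h' \<cdot> k')"
  using assms(3) inverse_arrsD[OF assms(1)] inverse_arrsD[OF assms(2)]
  by (auto simp: inverse_arrs_def cat_simps)

section \<open>Isomorphism classes of objects and their representatives\<close>

lemma isomorphic_iff:
  "isomorphic C A B \<longleftrightarrow> (\<exists>h k. inverse_arrs h k \<and> src C h = A \<and> tgt C h = B)"
  unfolding isomorphic_def iso_arr_iff Bex_def Hom_iff using inverse_arrsD(1) by blast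

lemma equiv_isomorphic: "equiv (objs C) {(A, B). A \<in> objs C \<and> B \<in> objs C \<and> isomorphic C A B}"
proof (intro equivI refl_onI symI transI)
  fix A assume "A \<in> objs C"
  then show "(A, A) \<in> {(A, B). A \<in> objs C \<and> B \<in> objs C \<and> isomorphic C A B}"
    using inverse_arrs_ident[of A] ident_arr[of A] by (auto simp: isomorphic_iff)
next
  fix A B assume "(A, B) \<in> {(A, B). A \<in> objs C \<and> B \<in> objs C \<and> isomorphic C A B}"
  then show "(B, A) \<in> {(A, B). A \<in> objs C \<and> B \<in> objs C \<and> isomorphic C A B}"
    by (auto simp: isomorphic_iff) (metis inverse_arrs_sym inverse_arrsD(3,4))
next
  fix A B D
  assume "(A, B) \<in> {(A, B). A \<in> objs C \<and> B \<in> objs C \<and> isomorphic C A B}"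
    and "(B, D) \<in> {(A, B). A \<in> objs C \<and> B \<in> objs C \<and> isomorphic C A B}"
  then show "(A, D) \<in> {(A, B). A \<in> objs C \<and> B \<in> objs C \<and> isomorphic C A B}"
    by (auto simp: isomorphic_iff) (metis inverse_arrs_cmp inverse_arrsD(1) cmp_arr(2,3))
qed auto

lemma rep_Iso:
  assumes "c \<in> Iso C"
  shows "rep c \<in> c" "rep c \<in> objs C"
proof -
  have "c \<noteq> {}" "c \<subseteq> objs C"
    using assms in_quotient_imp_non_empty[OF equiv_isomorphic]
      in_quotient_imp_subset[OF equiv_isomorphic] unfolding Iso_def by blast+
  then show "rep c \<in> c" "rep c \<in> objs C"
    unfolding rep_def by (metis someI_ex ex_in_conv, metis someI_ex ex_in_conv subsetD)
qed

lemma rep_isomorphic_imp_eq: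
  assumes "c \<in> Iso C" "d \<in> Iso C" "isomorphic C (rep c) (rep d)"
  shows "c = d"
  using quotient_eqI[OF equiv_isomorphic] assms rep_Iso unfolding Iso_def by blast

lemma ex_rep_isomorphic:
  assumes "A \<in> objs C"
  obtains c where "c \<in> Iso C" "isomorphic C A (rep c)"
proof -
  define c where "c = {(A, B). A \<in> objs C \<and> B \<in> objs C \<and> isomorphic C A B} `` {A}"
  have c: "c \<in> Iso C"
    unfolding c_def Iso_def using assms by (rule quotientI)
  then have "isomorphic C A (rep c)"
    using rep_Iso(1)[OF c] by (auto simp: c_def)
  with c show ?thesis
    by (rule that)
qed

section \<open>Monos and subobjects\<close>

lemma mono_arr_iff:
  "mono_arr C m \<longleftrightarrow> m \<in> arrs C \<and> (\<forall>x y. x \<in> arrs C \<longrightarrow> y \<in> arrs C \<longrightarrow> src C x = src C y \<longrightarrow>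
     tgt C x = src C m \<longrightarrow> tgt C y = src C m \<longrightarrow> m \<cdot> x = m \<cdot> y \<longrightarrow> x = y)"
  unfolding mono_arr_def Hom_def using src_closed by auto

text \<open>Needed to replace the source of a mono by a prescribed isomorphic object while keeping
  the subobject.\<close>

lemma mono_arr_cmp_iso:
  assumes "mono_arr C m" "inverse_arrs h k" "tgt C h = src C m"
  shows "mono_arr C (m \<cdot> h)"
  unfolding mono_arr_iff
proof (intro conjI allI impI)
  have m: "m \<in> arrs C"
    using assms(1) by (simp add: mono_arr_iff)
  note hk = inverse_arrsD[OF assms(2)]
  show "m \<cdot> h \<in> arrs C"
    using m hk assms(3) by (simp add: cat_simps)
  fix x y
  assume xy: "x \<in> arrs C" "y \<in> arrs C" "src C x = src C y" "tgt C x = src C (m \<cdot> h)"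
    "tgt C y = src C (m \<cdot> h)" "m \<cdot> h \<cdot> x = m \<cdot> h \<cdot> y"
  have t: "tgt C x = src C h" "tgt C y = src C h"
    using xy(4,5) m hk assms(3) by (auto simp: cat_simps)
  have "m \<cdot> (h \<cdot> x) = m \<cdot> (h \<cdot> y)"
    using xy t m hk assms(3) by (simp add: cat_simps)
  then have "h \<cdot> x = h \<cdot> y"
    using assms(1) xy(1-3) t hk assms(3) by (simp add: mono_arr_iff cmp_arr)
  then show "x = y"
    using hk(7) xy(1,2) t by metis
qed

end

text \<open>Gives a name to the relation written inline in \<open>subobjects\<close>, so that the
  general facts on quotients by an equivalence apply.\<close>

definition sub_rel :: "('o, 'm, 'x) cat_scheme \<Rightarrow> 'o \<Rightarrow> ('m \<times> 'm) set" where
  "sub_rel C K = {(u, v). mono_arr C u \<and> tgt C u = K \<and> mono_arr C v \<and> tgt C v = K \<and>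
        (\<exists>h \<in> Hom C (src C u) (src C v). iso_arr C h \<and> cmp C v h = u)}"

lemma subobjects_alt: "subobjects C K = {u. mono_arr C u \<and> tgt C u = K} // sub_rel C K"
  by (simp add: subobjects_def sub_rel_def)

context category
begin

lemma sub_rel_iff:
  "(u, v) \<in> sub_rel C K \<longleftrightarrow> mono_arr C u \<and> tgt C u = K \<and> mono_arr C v \<and> tgt C v = K \<and>
     (\<exists>h k. inverse_arrs h k \<and> src C h = src C u \<and> tgt C h = src C v \<and> v \<cdot> h = u)"
  unfolding sub_rel_def iso_arr_iff Bex_def Hom_iff using inverse_arrsD(1) by blast

lemma equiv_sub_rel: "equiv {u. mono_arr C u \<and> tgt C u = K} (sub_rel C K)"
proof (intro equivI refl_onI symI transI)
  fix u assume "u \<in> {u. mono_arr C u \<and> tgt C u = K}"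
  then show "(u, u) \<in> sub_rel C K"
    unfolding sub_rel_iff using inverse_arrs_ident[of "src C u"]
    by (auto simp: mono_arr_def cat_simps intro!: exI[of _ "ident C (src C u)"])
next
  fix u v assume uv: "(u, v) \<in> sub_rel C K"
  then obtain h k where hk: "inverse_arrs h k" "src C h = src C u" "tgt C h = src C v" "v \<cdot> h = u"
    by (auto simp: sub_rel_iff)
  have "v \<in> arrs C"
    using uv by (simp add: sub_rel_iff mono_arr_def)
  then have "u \<cdot> k = v"
    using hk inverse_arrsD[OF hk(1)] by (auto simp: cat_simps)
  then show "(v, u) \<in> sub_rel C K"
    using uv inverse_arrs_sym[OF hk(1)] hk inverse_arrsD(3,4)[OF hk(1)] unfolding sub_rel_iff by metis
next
  fix u v w assume uv: "(u, v) \<in> sub_rel C K" and vw: "(v, w) \<in> sub_rel C K"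
  from uv obtain h k where hk: "inverse_arrs h k" "src C h = src C u" "tgt C h = src C v" "v \<cdot> h = u"
    by (auto simp: sub_rel_iff)
  from vw obtain h' k' where hk': "inverse_arrs h' k'" "src C h' = src C v" "tgt C h' = src C w"
    "w \<cdot> h' = v"
    by (auto simp: sub_rel_iff)
  have w: "w \<in> arrs C"
    using vw by (simp add: sub_rel_iff mono_arr_def)
  have "inverse_arrs (h' \<cdot> h) (k \<cdot> k')"
    using hk hk' by (intro inverse_arrs_cmp) auto
  moreover have "w \<cdot> (h' \<cdot> h) = u"
    using hk hk' w inverse_arrsD[OF hk(1)] inverse_arrsD[OF hk'(1)]
    by (metis cmp_assoc_arr)
  ultimately show "(u, w) \<in> sub_rel C K"
    using uv vw hk hk' inverse_arrsD(1)[OF hk(1)] inverse_arrsD(1)[OF hk'(1)] unfolding sub_rel_iff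
    by (metis cmp_arr(2,3))
qed (auto simp: sub_rel_iff)

end

section \<open>Additive hom-sets, kernels and cokernels\<close>

context preadditive_category
begin

lemma Hom_objs: "f \<in> Hom C A B \<Longrightarrow> A \<in> objs C \<and> B \<in> objs C"
  by (auto simp: cat_simps)

lemma Hom_group_simps [simp]:
  "carrier (Hom_group C A B) = Hom C A B" "mult (Hom_group C A B) = add_arr C"
  "one (Hom_group C A B) = zero_arr C A B"
  by (simp_all add: Hom_group_def)

lemma zero_closed: "A \<in> objs C \<Longrightarrow> B \<in> objs C \<Longrightarrow> zero_arr C A B \<in> Hom C A B"
  using monoid.one_closed[OF group.is_monoid[OF comm_group.axioms(2)[OF Hom_comm_group]]] by simp

lemma add_closed:
  assumes "f \<in> Hom C A B" "g \<in> Hom C A B" shows "f \<boxplus> g \<in> Hom C A B"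
proof -
  interpret comm_group "Hom_group C A B"
    using Hom_objs[OF assms(1)] by (intro Hom_comm_group) auto
  show ?thesis using m_closed assms by simp
qed

lemma add_comm:
  assumes "f \<in> Hom C A B" "g \<in> Hom C A B" shows "f \<boxplus> g = g \<boxplus> f"
proof -
  interpret comm_group "Hom_group C A B"
    using Hom_objs[OF assms(1)] by (intro Hom_comm_group) auto
  show ?thesis using m_comm[of f g] assms by simp
qed

lemma add_zero:
  assumes "f \<in> Hom C A B"
  shows "f \<boxplus> zero_arr C A B = f" "zero_arr C A B \<boxplus> f = f"
proof -
  interpret comm_group "Hom_group C A B"
    using Hom_objs[OF assms(1)] by (intro Hom_comm_group) auto
  show "f \<boxplus> zero_arr C A B = f" "zero_arr C A B \<boxplus> f = f" using r_one l_one assms by simp_all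
qed

text \<open>The category record has no negation, so later arguments obtain differences as solutions
  of an equation. The witness is -g + f, formed in the group \<open>Hom_group C A B\<close>.\<close>

lemma ex_diff:
  assumes "f \<in> Hom C A B" "g \<in> Hom C A B"
  obtains d where "d \<in> Hom C A B" "g \<boxplus> d = f"
proof -
  interpret comm_group "Hom_group C A B"
    using Hom_objs[OF assms(1)] by (intro Hom_comm_group) auto
  show ?thesis
    using that[of "inv\<^bsub>Hom_group C A B\<^esub> g \<boxplus> f"] assms inv_closed[of g] m_closed
      inv_solve_left[of "inv\<^bsub>Hom_group C A B\<^esub> g \<boxplus> f" g f] by simp
qed

lemma add_cancel:
  assumes "f \<in> Hom C A B" "g \<in> Hom C A B" "h \<in> Hom C A B"
  shows "f \<boxplus> g = f \<boxplus> h \<longleftrightarrow> g = h"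
proof -
  interpret comm_group "Hom_group C A B"
    using Hom_objs[OF assms(1)] by (intro Hom_comm_group) auto
  show ?thesis using Units_l_cancel[of f g h] assms by auto
qed

lemma add_eq_self_iff:
  assumes "f \<in> Hom C A B" "g \<in> Hom C A B"
  shows "f \<boxplus> g = f \<longleftrightarrow> g = zero_arr C A B"
  using add_cancel[OF assms zero_closed] add_zero(1)[OF assms(1)] Hom_objs[OF assms(1)] by auto

text \<open>By distributivity the composite equals its own double, and cancelling one copy leaves
  zero.\<close>

lemma cmp_zero:
  assumes "g \<in> Hom C B D" "A \<in> objs C"
  shows "g \<cdot> zero_arr C A B = zero_arr C A D"
proof -
  have z: "zero_arr C A B \<in> Hom C A B"
    using assms Hom_objs zero_closed by blast
  have "g \<cdot> zero_arr C A B \<boxplus> g \<cdot> zero_arr C A B = g \<cdot> zero_arr C A B"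
    using cmp_add_right[OF z z assms(1)] add_zero(1)[OF z] by simp
  then show ?thesis
    using add_eq_self_iff cmp_closed[OF z assms(1)] by blast
qed

lemma zero_cmp:
  assumes "f \<in> Hom C A B" "D \<in> objs C"
  shows "zero_arr C B D \<cdot> f = zero_arr C A D"
proof -
  have z: "zero_arr C B D \<in> Hom C B D"
    using assms Hom_objs zero_closed by blast
  have "zero_arr C B D \<cdot> f \<boxplus> zero_arr C B D \<cdot> f = zero_arr C B D \<cdot> f"
    using cmp_add_left[OF assms(1) z z] add_zero(1)[OF z] by simp
  then show ?thesis
    using add_eq_self_iff cmp_closed[OF assms(1) z] by blast
qed

text \<open>Unique factorisation is split into existence and left cancellability of
  \<open>f\<close>. Cancellability follows from uniqueness because \<open>f \<cdot> u\<close> is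
  itself killed by \<open>g\<close>. The test object \<open>D\<close> may range over the whole type,
  since a nonempty hom-set has objects at both ends.\<close>

lemma is_kernel_iff:
  assumes "f \<in> Hom C B X" "g \<in> Hom C X A"
  shows "is_kernel C f g \<longleftrightarrow> g \<cdot> f = zero_arr C B A \<and>
    (\<forall>D. \<forall>h\<in>Hom C D X. g \<cdot> h = zero_arr C D A \<longrightarrow> (\<exists>u\<in>Hom C D B. f \<cdot> u = h)) \<and>
    (\<forall>D. \<forall>u\<in>Hom C D B. \<forall>v\<in>Hom C D B. f \<cdot> u = f \<cdot> v \<longrightarrow> u = v)" (is "_ \<longleftrightarrow> ?R")
proof
  assume k: "is_kernel C f g"
  then have gf: "g \<cdot> f = zero_arr C B A"
    using assms by (auto simp: is_kernel_def Hom_iff)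
  have lift: "\<exists>!u. u \<in> Hom C D B \<and> f \<cdot> u = h" if "h \<in> Hom C D X" "g \<cdot> h = zero_arr C D A" for D h
    using k that assms Hom_objs[OF that(1)] by (auto simp: is_kernel_def Hom_iff)
  have "u = v" if uv: "u \<in> Hom C D B" "v \<in> Hom C D B" "f \<cdot> u = f \<cdot> v" for D u v
  proof -
    have "g \<cdot> (f \<cdot> u) = zero_arr C D A"
      using cmp_assoc[OF uv(1) assms] gf zero_cmp[OF uv(1)] Hom_objs[OF assms(2)] by simp
    then show ?thesis
      using lift[OF cmp_closed[OF uv(1) assms(1)]] uv by metis
  qed
  then show ?R
    using gf lift by blast
next
  assume R: ?R
  then have "\<exists>!u. u \<in> Hom C D B \<and> f \<cdot> u = h"
    if "h \<in> Hom C D X" "g \<cdot> h = zero_arr C D A" for D h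
    using that by metis
  with R assms show "is_kernel C f g"
    by (auto simp: is_kernel_def Hom_def)
qed

lemma is_cokernel_iff:
  assumes "f \<in> Hom C B X" "g \<in> Hom C X A"
  shows "is_cokernel C g f \<longleftrightarrow> g \<cdot> f = zero_arr C B A \<and>
    (\<forall>D. \<forall>h\<in>Hom C X D. h \<cdot> f = zero_arr C B D \<longrightarrow> (\<exists>u\<in>Hom C A D. u \<cdot> g = h)) \<and>
    (\<forall>D. \<forall>u\<in>Hom C A D. \<forall>v\<in>Hom C A D. u \<cdot> g = v \<cdot> g \<longrightarrow> u = v)" (is "_ \<longleftrightarrow> ?R")
proof
  assume k: "is_cokernel C g f"
  then have gf: "g \<cdot> f = zero_arr C B A"
    using assms by (auto simp: is_cokernel_def Hom_iff)
  have desc: "\<exists>!u. u \<in> Hom C A D \<and> u \<cdot> g = h" if "h \<in> Hom C X D" "h \<cdot> f = zero_arr C B D" for D h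
    using k that assms Hom_objs[OF that(1)] by (auto simp: is_cokernel_def Hom_iff)
  have "u = v" if uv: "u \<in> Hom C A D" "v \<in> Hom C A D" "u \<cdot> g = v \<cdot> g" for D u v
  proof -
    have "(u \<cdot> g) \<cdot> f = zero_arr C B D"
      using cmp_assoc[OF assms uv(1)] gf cmp_zero[OF uv(1)] Hom_objs[OF assms(1)] by simp
    then show ?thesis
      using desc[OF cmp_closed[OF assms(2) uv(1)]] uv by metis
  qed
  then show ?R
    using gf desc by blast
next
  assume R: ?R
  then have "\<exists>!u. u \<in> Hom C A D \<and> u \<cdot> g = h"
    if "h \<in> Hom C X D" "h \<cdot> f = zero_arr C B D" for D h
    using that by metis
  with R assms show "is_cokernel C g f"
    by (auto simp: is_cokernel_def Hom_def)
qed

section \<open>Short exact sequences and their transport\<close>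

lemma short_exact_zero:
  "short_exact C f g \<Longrightarrow> f \<in> Hom C B X \<Longrightarrow> g \<in> Hom C X A \<Longrightarrow> g \<cdot> f = zero_arr C B A"
  by (auto simp: short_exact_def is_kernel_iff)

lemma short_exact_lift:
  assumes "short_exact C f g" "f \<in> Hom C B X" "g \<in> Hom C X A"
    "h \<in> Hom C D X" "g \<cdot> h = zero_arr C D A"
  obtains u where "u \<in> Hom C D B" "f \<cdot> u = h"
  using assms is_kernel_iff[OF assms(2,3)] unfolding short_exact_def by blast

lemma short_exact_descend:
  assumes "short_exact C f g" "f \<in> Hom C B X" "g \<in> Hom C X A"
    "h \<in> Hom C X D" "h \<cdot> f = zero_arr C B D"
  obtains u where "u \<in> Hom C A D" "u \<cdot> g = h"
  using assms is_cokernel_iff[OF assms(2,3)] unfolding short_exact_def by blast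

lemma short_exact_mono:
  assumes "short_exact C f g" "f \<in> Hom C B X" "g \<in> Hom C X A"
    "u \<in> Hom C D B" "v \<in> Hom C D B" "f \<cdot> u = f \<cdot> v"
  shows "u = v"
  using assms is_kernel_iff[OF assms(2,3)] unfolding short_exact_def by blast

lemma short_exact_epi:
  assumes "short_exact C f g" "f \<in> Hom C B X" "g \<in> Hom C X A"
    "u \<in> Hom C A D" "v \<in> Hom C A D" "u \<cdot> g = v \<cdot> g"
  shows "u = v"
  using assms is_cokernel_iff[OF assms(2,3)] unfolding short_exact_def by blast

lemma short_exactI:
  assumes "f \<in> Hom C B X" "g \<in> Hom C X A" "g \<cdot> f = zero_arr C B A"
    and "\<And>D h. h \<in> Hom C D X \<Longrightarrow> g \<cdot> h = zero_arr C D A \<Longrightarrow> \<exists>u\<in>Hom C D B. f \<cdot> u = h"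
    and "\<And>D h. h \<in> Hom C X D \<Longrightarrow> h \<cdot> f = zero_arr C B D \<Longrightarrow> \<exists>u\<in>Hom C A D. u \<cdot> g = h"
    and "\<And>D u v. u \<in> Hom C D B \<Longrightarrow> v \<in> Hom C D B \<Longrightarrow> f \<cdot> u = f \<cdot> v \<Longrightarrow> u = v"
    and "\<And>D u v. u \<in> Hom C A D \<Longrightarrow> v \<in> Hom C A D \<Longrightarrow> u \<cdot> g = v \<cdot> g \<Longrightarrow> u = v"
  shows "short_exact C f g"
  unfolding short_exact_def is_kernel_iff[OF assms(1,2)] is_cokernel_iff[OF assms(1,2)]
  using assms(3-) by blast

text \<open>Each test arrow is carried to the old sequence along the isomorphisms, factored or
  cancelled there, and carried back. Taking \<open>a\<close> and \<open>b\<close> to be identities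
  gives the action on middle terms; taking \<open>t\<close> to be an identity gives the action on
  the two ends.\<close>

lemma short_exact_transport:
  assumes se: "short_exact C f g" "f \<in> Hom C B X" "g \<in> Hom C X A"
    and b: "inverse_arrs b b'" "src C b = B'" "tgt C b = B"
    and t: "inverse_arrs t t'" "src C t = X" "tgt C t = X'"
    and a: "inverse_arrs a a'" "src C a = A" "tgt C a = A'"
  shows "short_exact C (t \<cdot> (f \<cdot> b)) (a \<cdot> (g \<cdot> t'))"
    and "t \<cdot> (f \<cdot> b) \<in> Hom C B' X'" and "a \<cdot> (g \<cdot> t') \<in> Hom C X' A'"
proof -
  note inv = inverse_arrsD[OF b(1)] inverse_arrsD[OF t(1)] inverse_arrsD[OF a(1)]
  have arr: "f \<in> arrs C" "src C f = B" "tgt C f = X" "g \<in> arrs C" "src C g = X" "tgt C g = A"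
    using se by (auto simp: Hom_iff)
  have aH: "a \<in> Hom C A A'" and bH: "b \<in> Hom C B' B"
    and a'H: "a' \<in> Hom C A' A" and b'H: "b' \<in> Hom C B B'"
    using inv a b by (auto simp: Hom_iff)
  have objs: "A \<in> objs C" "B \<in> objs C" "A' \<in> objs C" "B' \<in> objs C"
    using aH bH Hom_objs by blast+
  have gf: "g \<cdot> f = zero_arr C B A"
    by (rule short_exact_zero[OF se])
  show f': "t \<cdot> (f \<cdot> b) \<in> Hom C B' X'" and g': "a \<cdot> (g \<cdot> t') \<in> Hom C X' A'"
    using inv arr a b t by (auto simp: cat_simps)
  show "short_exact C (t \<cdot> (f \<cdot> b)) (a \<cdot> (g \<cdot> t'))"
  proof (rule short_exactI[OF f' g'])
    have "(a \<cdot> (g \<cdot> t')) \<cdot> (t \<cdot> (f \<cdot> b)) = a \<cdot> ((g \<cdot> f) \<cdot> b)"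
      using inv arr a b t by (auto simp: cat_simps)
    also have "\<dots> = zero_arr C B' A'"
      unfolding gf by (simp add: zero_cmp[OF bH objs(1)] cmp_zero[OF aH objs(4)])
    finally show "(a \<cdot> (g \<cdot> t')) \<cdot> (t \<cdot> (f \<cdot> b)) = zero_arr C B' A'" .
  next
    fix D h assume h: "h \<in> Hom C D X'" "(a \<cdot> (g \<cdot> t')) \<cdot> h = zero_arr C D A'"
    have D: "D \<in> objs C"
      using Hom_objs[OF h(1)] by simp
    have "g \<cdot> (t' \<cdot> h) = a' \<cdot> ((a \<cdot> (g \<cdot> t')) \<cdot> h)"
      using h(1) inv arr a b t by (auto simp: cat_simps)
    also have "\<dots> = zero_arr C D A"
      unfolding h(2) by (rule cmp_zero[OF a'H D])
    finally have "g \<cdot> (t' \<cdot> h) = zero_arr C D A" .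
    moreover have "t' \<cdot> h \<in> Hom C D X"
      using h(1) inv t by (auto simp: cat_simps)
    ultimately obtain u where u: "u \<in> Hom C D B" "f \<cdot> u = t' \<cdot> h"
      using short_exact_lift[OF se] by blast
    have "(t \<cdot> (f \<cdot> b)) \<cdot> (b' \<cdot> u) = t \<cdot> (f \<cdot> u)"
      using u(1) inv arr a b t by (auto simp: cat_simps)
    also have "\<dots> = h"
      unfolding u(2) using h(1) inv t by (auto simp: Hom_iff)
    finally show "\<exists>u\<in>Hom C D B'. (t \<cdot> (f \<cdot> b)) \<cdot> u = h"
      using cmp_closed[OF u(1) b'H] by blast
  next
    fix D h assume h: "h \<in> Hom C X' D" "h \<cdot> (t \<cdot> (f \<cdot> b)) = zero_arr C B' D"
    have D: "D \<in> objs C"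
      using Hom_objs[OF h(1)] by simp
    have "(h \<cdot> t) \<cdot> f = (h \<cdot> (t \<cdot> (f \<cdot> b))) \<cdot> b'"
      using h(1) inv arr a b t by (auto simp: cat_simps)
    also have "\<dots> = zero_arr C B D"
      unfolding h(2) by (rule zero_cmp[OF b'H D])
    finally have "(h \<cdot> t) \<cdot> f = zero_arr C B D" .
    moreover have "h \<cdot> t \<in> Hom C X D"
      using h(1) inv t by (auto simp: cat_simps)
    ultimately obtain u where u: "u \<in> Hom C A D" "u \<cdot> g = h \<cdot> t"
      using short_exact_descend[OF se] by blast
    have "(u \<cdot> a') \<cdot> (a \<cdot> (g \<cdot> t')) = (u \<cdot> g) \<cdot> t'"
      using u(1) inv arr a b t by (auto simp: cat_simps)
    also have "\<dots> = h"
      unfolding u(2) using h(1) inv t by (auto simp: cat_simps)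
    finally show "\<exists>u\<in>Hom C A' D. u \<cdot> (a \<cdot> (g \<cdot> t')) = h"
      using cmp_closed[OF a'H u(1)] by blast
  next
    fix D u v assume uv: "u \<in> Hom C D B'" "v \<in> Hom C D B'"
      "(t \<cdot> (f \<cdot> b)) \<cdot> u = (t \<cdot> (f \<cdot> b)) \<cdot> v"
    have "f \<cdot> (b \<cdot> w) = t' \<cdot> ((t \<cdot> (f \<cdot> b)) \<cdot> w)" if "w \<in> Hom C D B'" for w
      using that inv arr a b t by (auto simp: cat_simps)
    then have "f \<cdot> (b \<cdot> u) = f \<cdot> (b \<cdot> v)"
      using uv by simp
    then have "b \<cdot> u = b \<cdot> v"
      using short_exact_mono[OF se] cmp_closed[OF _ bH] uv(1,2) by blast
    moreover have "w = b' \<cdot> (b \<cdot> w)" if "w \<in> Hom C D B'" for w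
      using that inv b by (auto simp: Hom_iff)
    ultimately show "u = v"
      using uv(1,2) by metis
  next
    fix D u v assume uv: "u \<in> Hom C A' D" "v \<in> Hom C A' D"
      "u \<cdot> (a \<cdot> (g \<cdot> t')) = v \<cdot> (a \<cdot> (g \<cdot> t'))"
    have "(w \<cdot> a) \<cdot> g = (w \<cdot> (a \<cdot> (g \<cdot> t'))) \<cdot> t" if "w \<in> Hom C A' D" for w
      using that inv arr a b t by (auto simp: cat_simps)
    then have "(u \<cdot> a) \<cdot> g = (v \<cdot> a) \<cdot> g"
      using uv by simp
    then have "u \<cdot> a = v \<cdot> a"
      using short_exact_epi[OF se] cmp_closed[OF aH] uv(1,2) by blast
    moreover have "w = (w \<cdot> a) \<cdot> a'" if "w \<in> Hom C A' D" for w
      using that inv a by (auto simp: cat_simps)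
    ultimately show "u = v"
      using uv(1,2) by metis
  qed
qed

lemma short_exact_mono_arr:
  assumes "short_exact C f g" "f \<in> Hom C B X" "g \<in> Hom C X A"
  shows "mono_arr C f"
  unfolding mono_arr_def using assms(2) short_exact_mono[OF assms] by (auto simp: Hom_iff)

text \<open>The decomposition of \<open>ident C P\<close> supplies the factorisations: if p h = 0
  then h = j (q h), and if h j = 0 then h = (h i) p. Cancellability comes from the retraction
  \<open>q\<close> of \<open>j\<close> and the section \<open>i\<close> of \<open>p\<close>.\<close>

lemma short_exact_biproduct:
  assumes "is_biproduct C A B P i j p q"
  shows "short_exact C j p" "j \<in> Hom C B P" "p \<in> Hom C P A"
proof -
  have P: "i \<in> Hom C A P" "j \<in> Hom C B P" "p \<in> Hom C P A" "q \<in> Hom C P B"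
    "p \<cdot> i = ident C A" "q \<cdot> j = ident C B" "p \<cdot> j = zero_arr C B A" "q \<cdot> i = zero_arr C A B"
    "i \<cdot> p \<boxplus> j \<cdot> q = ident C P"
    using assms by (auto simp: is_biproduct_def)
  show "j \<in> Hom C B P" "p \<in> Hom C P A"
    by fact+
  note ip = cmp_closed[OF P(3,1)] and jq = cmp_closed[OF P(4,2)]
  have AB: "A \<in> objs C" "B \<in> objs C" "P \<in> objs C"
    using P Hom_objs by blast+
  show "short_exact C j p"
  proof (rule short_exactI[OF P(2,3,7)])
    fix D h assume h: "h \<in> Hom C D P" "p \<cdot> h = zero_arr C D A"
    have D: "D \<in> objs C"
      using Hom_objs[OF h(1)] by simp
    have "h = (i \<cdot> p \<boxplus> j \<cdot> q) \<cdot> h"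
      unfolding P(9) using cmp_ident_left[OF h(1)] by simp
    also have "\<dots> = (i \<cdot> p) \<cdot> h \<boxplus> (j \<cdot> q) \<cdot> h"
      by (rule cmp_add_left[OF h(1) ip jq])
    also have "\<dots> = zero_arr C D P \<boxplus> j \<cdot> (q \<cdot> h)"
      using cmp_assoc[OF h(1) P(3,1)] cmp_assoc[OF h(1) P(4,2)] h(2) cmp_zero[OF P(1) D] by simp
    also have "\<dots> = j \<cdot> (q \<cdot> h)"
      by (rule add_zero(2)[OF cmp_closed[OF cmp_closed[OF h(1) P(4)] P(2)]])
    finally show "\<exists>u\<in>Hom C D B. j \<cdot> u = h"
      using cmp_closed[OF h(1) P(4)] by metis
  next
    fix D h assume h: "h \<in> Hom C P D" "h \<cdot> j = zero_arr C B D"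
    have D: "D \<in> objs C"
      using Hom_objs[OF h(1)] by simp
    have "h = h \<cdot> (i \<cdot> p \<boxplus> j \<cdot> q)"
      unfolding P(9) using cmp_ident_right[OF h(1)] by simp
    also have "\<dots> = h \<cdot> (i \<cdot> p) \<boxplus> h \<cdot> (j \<cdot> q)"
      by (rule cmp_add_right[OF ip jq h(1)])
    also have "\<dots> = (h \<cdot> i) \<cdot> p \<boxplus> zero_arr C P D"
      using cmp_assoc[OF P(3,1) h(1)] cmp_assoc[OF P(4,2) h(1)] h(2) zero_cmp[OF P(4) D] by simp
    also have "\<dots> = (h \<cdot> i) \<cdot> p"
      by (rule add_zero(1)[OF cmp_closed[OF P(3) cmp_closed[OF P(1) h(1)]]])
    finally show "\<exists>u\<in>Hom C A D. u \<cdot> p = h"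
      using cmp_closed[OF P(1) h(1)] by metis
  next
    fix D u v assume "u \<in> Hom C D B" "v \<in> Hom C D B" "j \<cdot> u = j \<cdot> v"
    then show "u = v"
      using cmp_assoc[OF _ P(2,4)] P(6) cmp_ident_left by metis
  next
    fix D u v assume "u \<in> Hom C A D" "v \<in> Hom C A D" "u \<cdot> p = v \<cdot> p"
    then show "u = v"
      using cmp_assoc[OF P(1,3)] P(5) cmp_ident_right by metis
  qed
qed

end

section \<open>Extensions with prescribed middle term\<close>

text \<open>The set that is counted twice. The middle term is equal to \<open>K\<close>, not merely
  isomorphic to it, which makes the set finite in a finitary category.\<close>

definition extensions_with ::
  "('o, 'm, 'x) preadd_cat_scheme \<Rightarrow> 'o \<Rightarrow> 'o \<Rightarrow> 'o \<Rightarrow> ('m \<times> 'm) set" where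
  "extensions_with C A B K =
     {(f, g). short_exact C f g \<and> f \<in> Hom C B K \<and> g \<in> Hom C K A}"

text \<open>A class that has one representative with middle term \<open>X\<close> has one for every
  object isomorphic to \<open>X\<close>, so it suffices to ask that the class meet the sequences
  through \<open>K\<close> itself.\<close>

definition Ext1_with ::
  "('o, 'm, 'x) preadd_cat_scheme \<Rightarrow> 'o \<Rightarrow> 'o \<Rightarrow> 'o \<Rightarrow> ('m \<times> 'm) set set" where
  "Ext1_with C A B K = {\<xi> \<in> Ext1 C A B. \<xi> \<inter> extensions_with C A B K \<noteq> {}}"

section \<open>Equivalence of extensions and isomorphisms between them\<close>

context preadditive_category
begin

lemma extensions_iff: "(f, g) \<in> extensions C A B \<longleftrightarrow> (f, g) \<in> extensions_with C A B (tgt C f)"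
  by (auto simp: extensions_def extensions_with_def short_exact_def is_kernel_def Hom_iff)

lemma extensions_with_subset: "extensions_with C A B K \<subseteq> extensions C A B"
  by (auto simp: extensions_def extensions_with_def Hom_iff)

lemma ext_rel_iff:
  "((f, g), (f', g')) \<in> ext_rel C A B \<longleftrightarrow> (f, g) \<in> extensions C A B \<and> (f', g') \<in> extensions C A B \<and>
     (\<exists>h k. inverse_arrs h k \<and> src C h = tgt C f \<and> tgt C h = tgt C f' \<and> h \<cdot> f = f' \<and> g' \<cdot> h = g)"
  unfolding ext_rel_def iso_arr_iff Bex_def Hom_iff using inverse_arrsD(1) by blast

lemma equiv_ext_rel: "equiv (extensions C A B) (ext_rel C A B)"
proof (intro equivI refl_onI symI transI)
  show "ext_rel C A B \<subseteq> extensions C A B \<times> extensions C A B"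
    by (auto simp: ext_rel_def)
next
  fix e assume "e \<in> extensions C A B"
  moreover obtain f g where e: "e = (f, g)"
    by (cases e)
  ultimately have "f \<in> arrs C" "g \<in> arrs C" "src C g = tgt C f"
    by (auto simp: extensions_iff extensions_with_def Hom_iff)
  then show "(e, e) \<in> ext_rel C A B"
    using \<open>e \<in> extensions C A B\<close> inverse_arrs_ident[of "tgt C f"] unfolding e ext_rel_iff
    by (auto simp: cat_simps intro!: exI[of _ "ident C (tgt C f)"])
next
  fix e e' assume ee': "(e, e') \<in> ext_rel C A B"
  moreover obtain f g f' g' where e: "e = (f, g)" "e' = (f', g')"
    by (cases e, cases e')
  ultimately obtain h k where hk: "inverse_arrs h k" "src C h = tgt C f" "tgt C h = tgt C f'"
    "h \<cdot> f = f'" "g' \<cdot> h = g"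
    by (auto simp: ext_rel_iff)
  have "f \<in> arrs C" "g' \<in> arrs C" "src C g' = tgt C f'"
    using ee' unfolding e by (auto simp: ext_rel_iff extensions_iff extensions_with_def Hom_iff)
  then have "k \<cdot> f' = f" "g \<cdot> k = g'"
    using hk inverse_arrs_cancel[OF hk(1)] by auto
  then show "(e', e) \<in> ext_rel C A B"
    using ee' hk inverse_arrs_sym[OF hk(1)] inverse_arrsD(3,4)[OF hk(1)] unfolding e ext_rel_iff
    by metis
next
  fix e e' e'' assume ee': "(e, e') \<in> ext_rel C A B" and ee'': "(e', e'') \<in> ext_rel C A B"
  obtain f g f' g' f'' g'' where e: "e = (f, g)" "e' = (f', g')" "e'' = (f'', g'')"
    by (cases e, cases e', cases e'')
  from ee' obtain h k where hk: "inverse_arrs h k" "src C h = tgt C f" "tgt C h = tgt C f'"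
    "h \<cdot> f = f'" "g' \<cdot> h = g"
    unfolding e by (auto simp: ext_rel_iff)
  from ee'' obtain h' k' where hk': "inverse_arrs h' k'" "src C h' = tgt C f'" "tgt C h' = tgt C f''"
    "h' \<cdot> f' = f''" "g'' \<cdot> h' = g'"
    unfolding e by (auto simp: ext_rel_iff)
  have "f \<in> arrs C" "g'' \<in> arrs C" "src C g'' = tgt C f''"
    using ee' ee'' unfolding e
    by (auto simp: ext_rel_iff extensions_iff extensions_with_def Hom_iff)
  then have "(h' \<cdot> h) \<cdot> f = f''" "g'' \<cdot> (h' \<cdot> h) = g"
    using hk hk' inverse_arrsD[OF hk(1)] inverse_arrsD[OF hk'(1)]
    by (metis cmp_assoc_arr)+
  moreover have "inverse_arrs (h' \<cdot> h) (k \<cdot> k')"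
    using hk hk' by (intro inverse_arrs_cmp) auto
  ultimately show "(e, e'') \<in> ext_rel C A B"
    using ee' ee'' hk hk' inverse_arrsD(1)[OF hk(1)] inverse_arrsD(1)[OF hk'(1)]
    unfolding e ext_rel_iff by (metis cmp_arr(2,3))
qed

text \<open>Two isomorphisms between the same extensions differ by an arrow that is killed by
  \<open>g'\<close> and kills \<open>f\<close>, hence by f' p g for a unique \<open>p\<close> from
  \<open>A\<close> to \<open>B\<close>. The isomorphisms therefore form a torsor under
  \<open>Hom C A B\<close>; for equal extensions this is the stabiliser.\<close>

lemma card_middle_isos:
  assumes e: "(f, g) \<in> extensions_with C A B K" and e': "(f', g') \<in> extensions_with C A B K"
    and h: "h \<in> Aut C K" "h \<cdot> f = f'" "g' \<cdot> h = g"
  shows "card {h \<in> Aut C K. h \<cdot> f = f' \<and> g' \<cdot> h = g} = card (Hom C A B)"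
proof -
  have se: "short_exact C f g" "f \<in> Hom C B K" "g \<in> Hom C K A"
    and se': "short_exact C f' g'" "f' \<in> Hom C B K" "g' \<in> Hom C K A"
    using e e' by (auto simp: extensions_with_def)
  obtain k where hk: "inverse_arrs h k"
    using h(1) by (auto simp: Aut_def iso_arr_iff)
  note inv = inverse_arrsD[OF hk]
  have hH: "h \<in> Hom C K K"
    using h(1) by (simp add: Aut_def)
  then have kH: "k \<in> Hom C K K"
    using inv by (simp add: Hom_iff)
  have AB: "A \<in> objs C" "B \<in> objs C" "K \<in> objs C"
    using se Hom_objs by blast+
  have kf: "k \<cdot> f' = f" and gk: "g \<cdot> k = g'"
    using inverse_arrs_cancel[OF hk] h(2,3) hH se(2) se'(3) by (auto simp: Hom_iff)
  have pH: "f' \<cdot> (p \<cdot> g) \<in> Hom C K K" "f \<cdot> (p \<cdot> g') \<in> Hom C K K" if "p \<in> Hom C A B" for p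
    using that se se' cmp_closed by blast+
  have "bij_betw (\<lambda>p. h \<boxplus> f' \<cdot> (p \<cdot> g)) (Hom C A B) {h \<in> Aut C K. h \<cdot> f = f' \<and> g' \<cdot> h = g}"
    (is "bij_betw ?F _ ?T")
  proof (rule bij_betwI')
    fix p q assume p: "p \<in> Hom C A B" and q: "q \<in> Hom C A B"
    show "(?F p = ?F q) = (p = q)"
      using add_cancel[OF hH pH(1)[OF p] pH(1)[OF q]]
        short_exact_mono[OF se' cmp_closed[OF se(3) p] cmp_closed[OF se(3) q]]
        short_exact_epi[OF se p q] by blast
  next
    fix p assume p: "p \<in> Hom C A B"
    note pg = cmp_closed[OF se(3) p] and pg' = cmp_closed[OF se'(3) p]
    have F: "?F p \<in> Hom C K K"
      by (rule add_closed[OF hH pH(1)[OF p]])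
    have pgf: "(f' \<cdot> (p \<cdot> g)) \<cdot> f = zero_arr C B K"
      using cmp_assoc[OF se(2) pg se'(2)] cmp_assoc[OF se(2,3) p] short_exact_zero[OF se]
        cmp_zero[OF p AB(2)] cmp_zero[OF se'(2) AB(2)] by simp
    have "g' \<cdot> (f' \<cdot> (p \<cdot> g)) = zero_arr C K A"
      using cmp_assoc[OF pg se'(2,3)] short_exact_zero[OF se'] zero_cmp[OF pg AB(1)] by simp
    then have 1: "g' \<cdot> ?F p = g"
      using cmp_add_right[OF hH pH(1)[OF p] se'(3)] h(3) add_zero(1)[OF se(3)] by simp
    have 2: "?F p \<cdot> f = f'"
      using cmp_add_left[OF se(2) hH pH(1)[OF p]] pgf h(2) add_zero(1)[OF se'(2)] by simp
    \<comment> \<open>The inverse of h + f' p g is r = k - f p g'. Each composite with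
      \<open>r\<close> is computed by cancelling the common summand f p g, respectively f' p
      g'.\<close>
    obtain r where r: "r \<in> Hom C K K" "f \<cdot> (p \<cdot> g') \<boxplus> r = k"
      using ex_diff[OF kH pH(2)[OF p]] by blast
    have kF: "k \<cdot> ?F p = ident C K \<boxplus> f \<cdot> (p \<cdot> g)"
      using cmp_add_right[OF hH pH(1)[OF p] kH] cmp_assoc[OF pg se'(2) kH] kf inv(5) hH
      by (simp add: Hom_iff)
    have Fk: "?F p \<cdot> k = ident C K \<boxplus> f' \<cdot> (p \<cdot> g')"
      using cmp_add_left[OF kH hH pH(1)[OF p]] cmp_assoc[OF kH pg se'(2)] cmp_assoc[OF kH se(3) p]
        gk inv(6) hH by (simp add: Hom_iff)
    have I: "ident C K \<in> Hom C K K"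
      by (rule ident_closed[OF AB(3)])
    have fpg: "f \<cdot> (p \<cdot> g) \<in> Hom C K K" and fpg': "f' \<cdot> (p \<cdot> g') \<in> Hom C K K"
      using p se se' cmp_closed by blast+
    have L: "(f \<cdot> (p \<cdot> g')) \<cdot> ?F p = f \<cdot> (p \<cdot> g)"
      using cmp_assoc[OF F pg' se(2)] cmp_assoc[OF F se'(3) p] 1 by simp
    have R: "?F p \<cdot> (f \<cdot> (p \<cdot> g')) = f' \<cdot> (p \<cdot> g')"
      using cmp_assoc[OF pg' se(2) F] 2 by simp
    have rF: "r \<cdot> ?F p = ident C K"
    proof -
      have "f \<cdot> (p \<cdot> g) \<boxplus> r \<cdot> ?F p = k \<cdot> ?F p"
        using cmp_add_left[OF F pH(2)[OF p] r(1)] L r(2) by simp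
      also have "\<dots> = f \<cdot> (p \<cdot> g) \<boxplus> ident C K"
        unfolding kF by (rule add_comm[OF I fpg])
      finally show ?thesis
        using add_cancel[OF fpg cmp_closed[OF F r(1)] I] by simp
    qed
    have Fr: "?F p \<cdot> r = ident C K"
    proof -
      have "f' \<cdot> (p \<cdot> g') \<boxplus> ?F p \<cdot> r = ?F p \<cdot> k"
        using cmp_add_right[OF pH(2)[OF p] r(1) F] R r(2) by simp
      also have "\<dots> = f' \<cdot> (p \<cdot> g') \<boxplus> ident C K"
        unfolding Fk by (rule add_comm[OF I fpg'])
      finally show ?thesis
        using add_cancel[OF fpg' cmp_closed[OF r(1) F] I] by simp
    qed
    have "inverse_arrs (?F p) r"
      using F r(1) rF Fr by (simp add: inverse_arrs_def Hom_iff)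
    then show "?F p \<in> ?T"
      using F 1 2 by (auto simp: Aut_def iso_arr_iff)
  next
    fix h' assume "h' \<in> ?T"
    then have h': "h' \<in> Hom C K K" "h' \<cdot> f = f'" "g' \<cdot> h' = g"
      by (auto simp: Aut_def)
    \<comment> \<open>The difference \<open>d\<close> is killed by \<open>g'\<close>, so it lifts
      along \<open>f'\<close> to some \<open>u\<close>. It also kills \<open>f\<close>, so
      \<open>u \<cdot> f\<close> vanishes because \<open>f'\<close> is mono, and \<open>u\<close>
      descends along \<open>g\<close>.\<close>
    obtain d where d: "d \<in> Hom C K K" "h \<boxplus> d = h'"
      using ex_diff[OF h'(1) hH] by blast
    have "g \<boxplus> g' \<cdot> d = g"
      using cmp_add_right[OF hH d(1) se'(3)] d(2) h(3) h'(3) by simp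
    then have "g' \<cdot> d = zero_arr C K A"
      using add_eq_self_iff[OF se(3) cmp_closed[OF d(1) se'(3)]] by simp
    then obtain u where u: "u \<in> Hom C K B" "f' \<cdot> u = d"
      using short_exact_lift[OF se' d(1)] by blast
    have "f' \<boxplus> d \<cdot> f = f'"
      using cmp_add_left[OF se(2) hH d(1)] d(2) h(2) h'(2) by simp
    then have "d \<cdot> f = zero_arr C B K"
      using add_eq_self_iff[OF se'(2) cmp_closed[OF se(2) d(1)]] by simp
    then have "f' \<cdot> (u \<cdot> f) = f' \<cdot> zero_arr C B B"
      using cmp_assoc[OF se(2) u(1) se'(2)] u(2) cmp_zero[OF se'(2) AB(2)] by simp
    then have "u \<cdot> f = zero_arr C B B"
      using short_exact_mono[OF se' cmp_closed[OF se(2) u(1)] zero_closed[OF AB(2,2)]] by blast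
    then obtain p where "p \<in> Hom C A B" "p \<cdot> g = u"
      using short_exact_descend[OF se u(1)] by blast
    then show "\<exists>p\<in>Hom C A B. h' = ?F p"
      using u(2) d(2) by blast
  qed
  then show ?thesis
    by (simp add: bij_betw_same_card)
qed

lemma Ext1_class_eq:
  assumes "\<xi> \<in> Ext1 C A B" "e \<in> \<xi>"
  shows "e' \<in> \<xi> \<longleftrightarrow> (e, e') \<in> ext_rel C A B"
  using assms equiv_ext_rel[of A B] unfolding Ext1_def
  by (metis in_quotient_imp_closed quotient_eq_iff)

text \<open>An isomorphism of middle terms carries an extension to an equivalent one, and is itself
  the witness of the equivalence. For X = K this is the action of \<open>Aut C K\<close>.\<close>

lemma extensions_with_transport:
  assumes "(f, g) \<in> extensions_with C A B X" "inverse_arrs h k" "src C h = X" "tgt C h = K"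
  shows "(h \<cdot> f, g \<cdot> k) \<in> extensions_with C A B K"
    and "((f, g), (h \<cdot> f, g \<cdot> k)) \<in> ext_rel C A B"
proof -
  have se: "short_exact C f g" "f \<in> Hom C B X" "g \<in> Hom C X A"
    using assms by (auto simp: extensions_with_def)
  have AB: "A \<in> objs C" "B \<in> objs C"
    using se Hom_objs by blast+
  note inv = inverse_arrsD[OF assms(2)]
  note tr = short_exact_transport[OF se inverse_arrs_ident[OF AB(2)] ident_arr(2,3)[OF AB(2)]
      assms(2-4) inverse_arrs_ident[OF AB(1)] ident_arr(2,3)[OF AB(1)]]
  have "h \<cdot> (f \<cdot> ident C B) = h \<cdot> f" "ident C A \<cdot> (g \<cdot> k) = g \<cdot> k"
    using se inv assms by (auto simp: cat_simps)
  then show 1: "(h \<cdot> f, g \<cdot> k) \<in> extensions_with C A B K"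
    using tr by (simp add: extensions_with_def)
  have "(g \<cdot> k) \<cdot> h = g" "tgt C (h \<cdot> f) = K" "tgt C f = X"
    using se inv assms by (auto simp: cat_simps)
  then show "((f, g), (h \<cdot> f, g \<cdot> k)) \<in> ext_rel C A B"
    unfolding ext_rel_iff using 1 assms extensions_with_subset by blast
qed

end

section \<open>Riedtmann's formula\<close>

context finitary_abelian_category
begin

lemma finite_Aut: "A \<in> objs C \<Longrightarrow> finite (Aut C A)"
  unfolding Aut_def using finite_Hom by simp

lemma ident_Aut: "A \<in> objs C \<Longrightarrow> ident C A \<in> Aut C A"
  using inverse_arrs_ident ident_closed by (auto simp: Aut_def iso_arr_iff)

lemma Aut_iff: "h \<in> Aut C A \<longleftrightarrow> (\<exists>k. inverse_arrs h k \<and> src C h = A \<and> tgt C h = A)"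
  by (auto simp: Aut_def iso_arr_iff Hom_iff inverse_arrs_def)

lemma finite_extensions_with:
  assumes "A \<in> objs C" "B \<in> objs C" "K \<in> objs C"
  shows "finite (extensions_with C A B K)"
  by (rule finite_subset[of _ "Hom C B K \<times> Hom C K A"])
    (use assms finite_Hom in \<open>auto simp: extensions_with_def\<close>)

text \<open>Orbit-stabiliser counting without a formal group action. With a base extension in \<xi>
  fixed, the members of \<xi> through \<open>K\<close> form its orbit, and the automorphisms that
  reach a given member are counted by \<open>card_middle_isos\<close>.\<close>

lemma card_Aut_eq:
  assumes obj: "A \<in> objs C" "B \<in> objs C" "K \<in> objs C" and xi: "\<xi> \<in> Ext1_with C A B K"
  shows "card (Aut C K) = card (Hom C A B) * card (\<xi> \<inter> extensions_with C A B K)"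
proof -
  obtain f g where e: "(f, g) \<in> \<xi>" "(f, g) \<in> extensions_with C A B K" and xi': "\<xi> \<in> Ext1 C A B"
    using xi by (auto simp: Ext1_with_def)
  have fg: "f \<in> Hom C B K" "g \<in> Hom C K A"
    using e by (auto simp: extensions_with_def)
  \<comment> \<open>The automorphisms that move the base extension to \<open>(f', g')\<close>;
    writing g' h = g avoids the inverse of \<open>h\<close>.\<close>
  define T where "T = (\<lambda>(f', g'). {h \<in> Aut C K. h \<cdot> f = f' \<and> g' \<cdot> h = g})"
  show ?thesis
  proof (rule card_disjoint_fibres)
    show "finite (Aut C K)" "finite (\<xi> \<inter> extensions_with C A B K)"
      using finite_Aut finite_extensions_with obj by auto
    show "Aut C K = (\<Union>e'\<in>\<xi> \<inter> extensions_with C A B K. T e')"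
    proof (intro equalityI subsetI)
      fix h assume h: "h \<in> Aut C K"
      then obtain k where hk: "inverse_arrs h k" "src C h = K" "tgt C h = K"
        by (auto simp: Aut_iff)
      have "(h \<cdot> f, g \<cdot> k) \<in> \<xi> \<inter> extensions_with C A B K"
        using extensions_with_transport[OF e(2) hk] Ext1_class_eq[OF xi' e(1)] by blast
      moreover have "(g \<cdot> k) \<cdot> h = g"
        using inverse_arrsD[OF hk(1)] hk fg by (auto simp: cat_simps)
      ultimately show "h \<in> (\<Union>e'\<in>\<xi> \<inter> extensions_with C A B K. T e')"
        using h by (intro UN_I[of "(h \<cdot> f, g \<cdot> k)"]) (auto simp: T_def)
    qed (auto simp: T_def)
    fix e' assume e': "e' \<in> \<xi> \<inter> extensions_with C A B K"
    obtain f' g' where eq: "e' = (f', g')"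
      by (cases e')
    \<comment> \<open>\<open>card_middle_isos\<close> needs one element of the fibre. The
      equivalence supplies an isomorphism, which is an automorphism because both middle terms equal
      \<open>K\<close>.\<close>
    have "((f, g), (f', g')) \<in> ext_rel C A B"
      using Ext1_class_eq[OF xi' e(1)] e' eq by blast
    moreover have "tgt C f = K" "tgt C f' = K"
      using e' e eq by (auto simp: extensions_with_def Hom_iff)
    ultimately obtain h where "h \<in> Aut C K" "h \<cdot> f = f'" "g' \<cdot> h = g"
      by (auto simp: ext_rel_iff Aut_iff)
    then show "card (T e') = card (Hom C A B)"
      using card_middle_isos[OF e(2)] e' unfolding eq T_def by simp
  next
    fix e1 e2 h
    assume e12: "e1 \<in> \<xi> \<inter> extensions_with C A B K" "e2 \<in> \<xi> \<inter> extensions_with C A B K"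
      "h \<in> T e1" "h \<in> T e2"
    obtain f1 g1 f2 g2 where eq: "e1 = (f1, g1)" "e2 = (f2, g2)"
      by (cases e1, cases e2)
    have h: "h \<in> Aut C K" "f1 = f2" "g1 \<cdot> h = g2 \<cdot> h"
      using e12 by (auto simp: eq T_def)
    obtain k where hk: "inverse_arrs h k" "src C h = K" "tgt C h = K"
      using h by (auto simp: Aut_iff)
    have "g' = (g' \<cdot> h) \<cdot> k" if "g' \<in> Hom C K A" for g'
      using that inverse_arrsD[OF hk(1)] hk by (auto simp: cat_simps)
    moreover have "g1 \<in> Hom C K A" "g2 \<in> Hom C K A"
      using e12 by (auto simp: eq extensions_with_def)
    ultimately show "e1 = e2"
      using h eq by metis
  qed
qed

text \<open>The extension classes cut the sequences through \<open>K\<close> into orbits, all of the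
  same size by \<open>card_Aut_eq\<close>.\<close>

lemma card_extensions_with_Ext1:
  assumes obj: "A \<in> objs C" "B \<in> objs C" "K \<in> objs C"
  shows "card (Hom C A B) * card (extensions_with C A B K) =
    card (Aut C K) * card (Ext1_with C A B K)"
proof -
  have pos: "card (Hom C A B) > 0"
    using zero_closed finite_Hom obj by (metis card_gt_0_iff empty_iff)
  have "card (extensions_with C A B K) =
      card (Aut C K) div card (Hom C A B) * card (Ext1_with C A B K)"
  proof (rule card_disjoint_fibres)
    show "finite (extensions_with C A B K)" "finite (Ext1_with C A B K)"
      using finite_extensions_with finite_Ext1 obj by (auto simp: Ext1_with_def)
    show "extensions_with C A B K = (\<Union>\<xi>\<in>Ext1_with C A B K. \<xi> \<inter> extensions_with C A B K)"
      using extensions_with_subset[of A B K] Union_quotient[OF equiv_ext_rel[of A B]]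
      by (fastforce simp: Ext1_with_def Ext1_def)
    show "card (\<xi> \<inter> extensions_with C A B K) = card (Aut C K) div card (Hom C A B)"
      if "\<xi> \<in> Ext1_with C A B K" for \<xi>
      using card_Aut_eq[OF obj that] pos by simp
    show "\<xi> = \<xi>'" if "\<xi> \<in> Ext1_with C A B K" "\<xi>' \<in> Ext1_with C A B K"
      "e \<in> \<xi> \<inter> extensions_with C A B K" "e \<in> \<xi>' \<inter> extensions_with C A B K" for \<xi> \<xi>' e
      using that quotient_disj[OF equiv_ext_rel[of A B]] unfolding Ext1_with_def Ext1_def by blast
  qed
  \<comment> \<open>The division of natural numbers above is exact once some class exists; without
    any class both sides are zero.\<close>
  moreover have "card (Hom C A B) dvd card (Aut C K)" if "Ext1_with C A B K \<noteq> {}"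
    using that card_Aut_eq[OF obj] by fastforce
  ultimately show ?thesis
    by (cases "Ext1_with C A B K = {}") (auto simp: mult.assoc[symmetric])
qed

section \<open>Short exact sequences over a fixed subobject\<close>

text \<open>The set whose cardinality is \<open>hall_number C A B K\<close>.\<close>

definition sub_quot :: "'o \<Rightarrow> 'o \<Rightarrow> 'o \<Rightarrow> 'm set set" where
  "sub_quot A B K = {U \<in> subobjects C K. \<exists>u \<in> U. isomorphic C (src C u) B \<and>
     (\<exists>c. is_cokernel C c u \<and> isomorphic C (tgt C c) A)}"

text \<open>By normality \<open>u\<close> is the kernel of some \<open>f\<close>, and
  \<open>f\<close> factors through \<open>c\<close>. Whatever \<open>c\<close> kills is then killed
  by \<open>f\<close> and lifts along \<open>u\<close>.\<close>

lemma mono_is_kernel_of_cokernel: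
  assumes "mono_arr C u" "is_cokernel C c u"
  shows "short_exact C u c"
proof -
  obtain f where f: "is_kernel C u f"
    using mono_normal[OF assms(1)] by blast
  define B X A D where "B = src C u" "X = tgt C u" "A = tgt C c" "D = tgt C f"
  have H: "u \<in> Hom C B X" "c \<in> Hom C X A" "f \<in> Hom C X D"
    using f assms(2) by (auto simp: is_kernel_def is_cokernel_def Hom_iff B_X_A_D_def)
  note k = f[unfolded is_kernel_iff[OF H(1,3)]] and c = assms(2)[unfolded is_cokernel_iff[OF H(1,2)]]
  obtain d where d: "d \<in> Hom C A D" "d \<cdot> c = f"
    using c k H by blast
  have "f \<cdot> h = zero_arr C E D" if "h \<in> Hom C E X" "c \<cdot> h = zero_arr C E A" for E h
    using that d cmp_assoc[OF that(1) H(2) d(1)] cmp_zero[OF d(1)] Hom_objs[OF that(1)] by auto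
  then have "is_kernel C u c"
    unfolding is_kernel_iff[OF H(1,2)] using k c by blast
  then show ?thesis
    using assms(2) by (simp add: short_exact_def)
qed

text \<open>The Hall number fixes sub and quotient only up to isomorphism. Composing with chosen
  isomorphisms makes the ends equal to \<open>B\<close> and \<open>A\<close>, and the altered mono
  still represents \<open>U\<close>.\<close>

lemma sub_quot_representative:
  assumes "U \<in> sub_quot A B K"
  obtains f g where "f \<in> U" "(f, g) \<in> extensions_with C A B K"
proof -
  obtain u c where u: "u \<in> U" "U \<in> subobjects C K" "isomorphic C (src C u) B" "is_cokernel C c u"
    "isomorphic C (tgt C c) A"
    using assms by (auto simp: sub_quot_def)
  have m: "mono_arr C u" "tgt C u = K"
    using u(1,2) in_quotient_imp_subset[OF equiv_sub_rel] unfolding subobjects_alt by blast+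
  have H: "u \<in> Hom C (src C u) K" "c \<in> Hom C K (tgt C c)"
    using u(4) m by (auto simp: is_cokernel_def Hom_iff)
  obtain b b' where b: "inverse_arrs b b'" "src C b = src C u" "tgt C b = B"
    using u(3) by (auto simp: isomorphic_iff)
  obtain a a' where a: "inverse_arrs a a'" "src C a = tgt C c" "tgt C a = A"
    using u(5) by (auto simp: isomorphic_iff)
  note bi = inverse_arrsD[OF b(1)] and ai = inverse_arrsD[OF a(1)]
  have K: "K \<in> objs C"
    using H Hom_objs by blast
  note tr = short_exact_transport[OF mono_is_kernel_of_cokernel[OF m(1) u(4)] H
      inverse_arrs_sym[OF b(1)] bi(3)[unfolded b] bi(4)[unfolded b] inverse_arrs_ident[OF K]
      ident_arr(2,3)[OF K] a]
  have "ident C K \<cdot> (u \<cdot> b') = u \<cdot> b'" "a \<cdot> (c \<cdot> ident C K) = a \<cdot> c"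
    using H bi ai a b K by (auto simp: cat_simps)
  then have ext: "(u \<cdot> b', a \<cdot> c) \<in> extensions_with C A B K"
    using tr by (simp add: extensions_with_def)
  have mono: "mono_arr C (u \<cdot> b')"
    using mono_arr_cmp_iso[OF m(1) inverse_arrs_sym[OF b(1)]] bi b by simp
  have "(u \<cdot> b') \<cdot> b = u" "tgt C (u \<cdot> b') = K" "src C (u \<cdot> b') = B"
    using H bi b by (auto simp: cat_simps)
  then have "(u, u \<cdot> b') \<in> sub_rel C K"
    unfolding sub_rel_iff using m mono b by blast
  then have "u \<cdot> b' \<in> U"
    using u(1,2) in_quotient_imp_closed[OF equiv_sub_rel] unfolding subobjects_alt by blast
  then show ?thesis
    using ext that by blast
qed

text \<open>From one sequence \<open>(f, g)\<close> over \<open>U\<close> every other is (f b, a g)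
  for automorphisms \<open>a\<close> and \<open>b\<close>, which are unique because \<open>f\<close>
  is mono and \<open>g\<close> is epi.\<close>

lemma card_extensions_on_subobject:
  assumes obj: "A \<in> objs C" "B \<in> objs C" "K \<in> objs C" and U: "U \<in> sub_quot A B K"
  shows "card {(f, g) \<in> extensions_with C A B K. f \<in> U} = card (Aut C A) * card (Aut C B)"
proof -
  obtain f g where fU: "f \<in> U" and e: "(f, g) \<in> extensions_with C A B K"
    using sub_quot_representative[OF U] by blast
  have se: "short_exact C f g" "f \<in> Hom C B K" "g \<in> Hom C K A"
    using e by (auto simp: extensions_with_def)
  have Uq: "U \<in> {u. mono_arr C u \<and> tgt C u = K} // sub_rel C K"
    using U by (simp add: sub_quot_def subobjects_alt)
  have U_iff: "f' \<in> U \<longleftrightarrow> (f', f) \<in> sub_rel C K" for f'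
    using Uq fU quotient_eq_iff[OF equiv_sub_rel Uq Uq]
      in_quotient_imp_closed[OF equiv_sub_rel Uq] equiv_sub_rel[of K]
    by (metis equivE symE)
  have "bij_betw (\<lambda>(a, b). (f \<cdot> b, a \<cdot> g)) (Aut C A \<times> Aut C B)
      {(f, g) \<in> extensions_with C A B K. f \<in> U}" (is "bij_betw ?F _ ?T")
  proof (rule bij_betwI')
    fix x y assume "x \<in> Aut C A \<times> Aut C B" "y \<in> Aut C A \<times> Aut C B"
    moreover obtain a b a' b' where eq: "x = (a, b)" "y = (a', b')"
      by (cases x, cases y)
    ultimately have "a \<in> Hom C A A" "a' \<in> Hom C A A" "b \<in> Hom C B B" "b' \<in> Hom C B B"
      by (auto simp: Aut_def)
    then show "(?F x = ?F y) = (x = y)"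
      unfolding eq using short_exact_mono[OF se] short_exact_epi[OF se] by auto
  next
    fix x assume "x \<in> Aut C A \<times> Aut C B"
    moreover obtain a b where eq: "x = (a, b)"
      by (cases x)
    ultimately obtain a' b' where a: "inverse_arrs a a'" "src C a = A" "tgt C a = A"
      and b: "inverse_arrs b b'" "src C b = B" "tgt C b = B"
      by (auto simp: Aut_iff)
    note tr = short_exact_transport[OF se b inverse_arrs_ident[OF obj(3)]
        ident_arr(2,3)[OF obj(3)] a]
    have "ident C K \<cdot> (f \<cdot> b) = f \<cdot> b" "a \<cdot> (g \<cdot> ident C K) = a \<cdot> g"
      using se inverse_arrsD[OF a(1)] inverse_arrsD[OF b(1)] a b by (auto simp: cat_simps)
    then have ext: "short_exact C (f \<cdot> b) (a \<cdot> g)" "f \<cdot> b \<in> Hom C B K" "a \<cdot> g \<in> Hom C K A"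
      using tr by simp_all
    have "(f \<cdot> b, f) \<in> sub_rel C K"
      unfolding sub_rel_iff
      using short_exact_mono_arr[OF se] short_exact_mono_arr[OF ext] se ext b by (auto simp: Hom_iff)
    then show "?F x \<in> ?T"
      using ext by (simp add: eq U_iff extensions_with_def)
  next
    fix y assume "y \<in> ?T"
    then obtain f' g' where y: "y = (f', g')" "(f', g') \<in> extensions_with C A B K" "f' \<in> U"
      by blast
    have se': "short_exact C f' g'" "f' \<in> Hom C B K" "g' \<in> Hom C K A"
      using y by (auto simp: extensions_with_def)
    obtain b b' where b: "inverse_arrs b b'" "src C b = B" "tgt C b = B" "f \<cdot> b = f'"
      using y(3) se se' unfolding U_iff sub_rel_iff by (auto simp: Hom_iff)
    have bH: "b \<in> Hom C B B" "b' \<in> Hom C B B"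
      using inverse_arrsD[OF b(1)] b by (auto simp: Hom_iff)
    have fb: "f' \<cdot> b' = f"
      using inverse_arrsD[OF b(1)] b se by (auto simp: cat_simps)
    \<comment> \<open>As \<open>f\<close> and \<open>f'\<close> factor through each other,
      \<open>g'\<close> kills \<open>f\<close> and \<open>g\<close> kills \<open>f'\<close>. The
      induced arrows \<open>a\<close> and \<open>a'\<close> between the quotients are mutually
      inverse because \<open>g\<close> and \<open>g'\<close> are epi.\<close>
    have "g' \<cdot> f = zero_arr C B A"
      using cmp_assoc[OF bH(2) se'(2,3)] fb short_exact_zero[OF se'] zero_cmp[OF bH(2) obj(1)]
      by simp
    then obtain a where a: "a \<in> Hom C A A" "a \<cdot> g = g'"
      using short_exact_descend[OF se se'(3)] by blast
    have "g \<cdot> f' = zero_arr C B A"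
      using cmp_assoc[OF bH(1) se(2,3)] b(4) short_exact_zero[OF se] zero_cmp[OF bH(1) obj(1)]
      by simp
    then obtain a' where a': "a' \<in> Hom C A A" "a' \<cdot> g' = g"
      using short_exact_descend[OF se' se(3)] by blast
    have I: "ident C A \<in> Hom C A A"
      using ident_closed[OF obj(1)] .
    have "(a' \<cdot> a) \<cdot> g = ident C A \<cdot> g" "(a \<cdot> a') \<cdot> g' = ident C A \<cdot> g'"
      using cmp_assoc[OF se(3) a(1) a'(1)] cmp_assoc[OF se'(3) a'(1) a(1)] a a'
        cmp_ident_left[OF se(3)] cmp_ident_left[OF se'(3)] by simp_all
    then have "a' \<cdot> a = ident C A" "a \<cdot> a' = ident C A"
      using short_exact_epi[OF se cmp_closed[OF a(1) a'(1)] I]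
        short_exact_epi[OF se' cmp_closed[OF a'(1) a(1)] I] by blast+
    then have "inverse_arrs a a'"
      using a(1) a'(1) by (auto simp: inverse_arrs_def Hom_iff)
    then have "(a, b) \<in> Aut C A \<times> Aut C B"
      using a(1) b by (auto simp: Aut_iff Hom_iff)
    then show "\<exists>x\<in>Aut C A \<times> Aut C B. y = ?F x"
      using a(2) b(4) y(1) by (intro bexI[of _ "(a, b)"]) auto
  qed
  then show ?thesis
    by (simp add: bij_betw_same_card[symmetric] card_cartesian_product)
qed

text \<open>Every sequence lies over exactly one subobject, the class of its mono, and all fibres
  have the size found in \<open>card_extensions_on_subobject\<close>.\<close>

lemma card_extensions_with_hall:
  assumes obj: "A \<in> objs C" "B \<in> objs C" "K \<in> objs C"
  shows "card (extensions_with C A B K) = card (Aut C A) * card (Aut C B) * hall_number C A B K"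
proof -
  let ?T = "\<lambda>U. {(f, g) \<in> extensions_with C A B K. f \<in> U}"
  have disj: "U = V" if "U \<in> sub_quot A B K" "V \<in> sub_quot A B K" "e \<in> ?T U" "e \<in> ?T V" for U V e
    using that quotient_disj[OF equiv_sub_rel[of K]] unfolding sub_quot_def subobjects_alt by blast
  have "card (extensions_with C A B K) = card (Aut C A) * card (Aut C B) * card (sub_quot A B K)"
  proof (rule card_disjoint_fibres[where T = ?T])
    show fin: "finite (extensions_with C A B K)"
      using finite_extensions_with obj by simp
    \<comment> \<open>Finiteness of the set of subobjects is derived here: the fibres are nonempty
      and disjoint, so they embed it into the power set of a finite set.\<close>
    have "inj_on ?T (sub_quot A B K)"
    proof (rule inj_onI)
      fix U V assume UV: "U \<in> sub_quot A B K" "V \<in> sub_quot A B K" "?T U = ?T V"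
      obtain f g where "f \<in> U" "(f, g) \<in> extensions_with C A B K"
        using sub_quot_representative[OF UV(1)] by blast
      then have "(f, g) \<in> ?T U"
        by simp
      then show "U = V"
        using disj[OF UV(1,2)] UV(3) by blast
    qed
    moreover have "?T ` sub_quot A B K \<subseteq> Pow (extensions_with C A B K)"
      by auto
    ultimately show "finite (sub_quot A B K)"
      using fin by (meson finite_Pow_iff finite_imageD finite_subset)
    show "extensions_with C A B K = (\<Union>U\<in>sub_quot A B K. ?T U)"
    proof (intro equalityI subsetI)
      fix e assume e: "e \<in> extensions_with C A B K"
      obtain f g where eq: "e = (f, g)"
        by (cases e)
      have se: "short_exact C f g" "f \<in> Hom C B K" "g \<in> Hom C K A"
        using e eq by (auto simp: extensions_with_def)
      have f: "f \<in> {u. mono_arr C u \<and> tgt C u = K}"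
        using short_exact_mono_arr[OF se] se by (auto simp: Hom_iff)
      define U where "U = sub_rel C K `` {f}"
      have "f \<in> U"
        unfolding U_def using f by (rule equiv_class_self[OF equiv_sub_rel])
      moreover have "U \<in> subobjects C K"
        unfolding U_def subobjects_alt using f by (rule quotientI)
      moreover have "isomorphic C D D" if "D \<in> objs C" for D
        using inverse_arrs_ident[OF that] ident_arr[OF that] by (auto simp: isomorphic_iff)
      ultimately have "U \<in> sub_quot A B K"
        using se obj by (auto simp: sub_quot_def short_exact_def Hom_iff)
      then show "e \<in> (\<Union>U\<in>sub_quot A B K. ?T U)"
        using \<open>f \<in> U\<close> e eq by auto
    qed auto
    show "card (?T U) = card (Aut C A) * card (Aut C B)" if "U \<in> sub_quot A B K" for U
      by (rule card_extensions_on_subobject[OF obj that])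
  qed (rule disj)
  then show ?thesis
    by (simp add: hall_number_def sub_quot_def)
qed

text \<open>Riedtmann's formula: equate the two counts of \<open>extensions_with C A B K\<close> and
  divide by the nonzero order of \<open>Aut C K\<close>.\<close>

lemma comult_coeff_eq:
  assumes obj: "A \<in> objs C" "B \<in> objs C" "K \<in> objs C"
  shows "comult_coeff C A B K = of_nat (card (Ext1_with C A B K)) / of_nat (card (Ext1 C A B))"
proof -
  have pos: "card (Aut C K) \<noteq> 0"
    using ident_Aut finite_Aut obj by (metis card_0_eq empty_iff)
  have "card (Hom C A B) * (card (Aut C A) * card (Aut C B) * hall_number C A B K) =
      card (Aut C K) * card (Ext1_with C A B K)"
    using card_extensions_with_Ext1[OF obj] card_extensions_with_hall[OF obj] by simp
  then have "(of_nat (card (Hom C A B)) * (of_nat (card (Aut C A)) * of_nat (card (Aut C B)) *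
      of_nat (hall_number C A B K)) :: rat) =
      of_nat (card (Aut C K)) * of_nat (card (Ext1_with C A B K))"
    by (metis of_nat_mult)
  then show ?thesis
    unfolding comult_coeff_def dual_hall_number_def using pos by (simp add: field_simps)
qed

section \<open>Summing over the middle terms\<close>

text \<open>The split extension on a biproduct gives a class. This keeps the denominator in the
  final quotient away from zero.\<close>

lemma Ext1_nonempty:
  assumes "A \<in> objs C" "B \<in> objs C"
  shows "Ext1 C A B \<noteq> {}"
proof -
  obtain P i j p q where "is_biproduct C A B P i j p q"
    using biproduct_exists[OF assms] by blast
  then have "(j, p) \<in> extensions_with C A B P"
    using short_exact_biproduct by (simp add: extensions_with_def)
  then show ?thesis
    unfolding Ext1_def quotient_def using extensions_with_subset by blast
qed

text \<open>Equivalence of extensions includes an isomorphism of middle terms. Non-isomorphic middle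
  terms therefore own disjoint sets of extension classes.\<close>

lemma Ext1_with_middle_unique:
  assumes "\<xi> \<in> Ext1_with C A B K" "\<xi> \<in> Ext1_with C A B L"
  shows "isomorphic C K L"
proof -
  obtain f g f' g' where e: "(f, g) \<in> \<xi>" "(f', g') \<in> \<xi>" "(f, g) \<in> extensions_with C A B K"
    "(f', g') \<in> extensions_with C A B L" and "\<xi> \<in> Ext1 C A B"
    using assms by (auto simp: Ext1_with_def)
  then have "((f, g), (f', g')) \<in> ext_rel C A B"
    using Ext1_class_eq by blast
  then show ?thesis
    using e by (auto simp: ext_rel_iff isomorphic_iff extensions_with_def Hom_iff)
qed

text \<open>The middle term of a representative is only isomorphic to some \<open>rep c\<close>;
  transport along such an isomorphism stays in the same class and reaches \<open>rep c\<close>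
  exactly.\<close>

lemma Ext1_eq_Union_middle_terms:
  "Ext1 C A B = (\<Union>c\<in>Iso C. Ext1_with C A B (rep c))"
proof (intro equalityI subsetI)
  fix \<xi> assume xi: "\<xi> \<in> Ext1 C A B"
  then obtain f g where e: "(f, g) \<in> \<xi>" "(f, g) \<in> extensions C A B"
    unfolding Ext1_def
    by (metis equiv_ext_rel in_quotient_imp_non_empty in_quotient_imp_subset ex_in_conv
        subsetD surj_pair)
  then have ew: "(f, g) \<in> extensions_with C A B (tgt C f)"
    by (simp add: extensions_iff)
  then have "tgt C f \<in> objs C"
    by (auto simp: extensions_with_def Hom_iff tgt_closed)
  then obtain c where c: "c \<in> Iso C" "isomorphic C (tgt C f) (rep c)"
    using ex_rep_isomorphic by blast
  obtain h k where "inverse_arrs h k" "src C h = tgt C f" "tgt C h = rep c"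
    using c(2) by (auto simp: isomorphic_iff)
  note tr = extensions_with_transport[OF ew this]
  have "(h \<cdot> f, g \<cdot> k) \<in> \<xi>"
    using Ext1_class_eq[OF xi e(1)] tr(2) by blast
  then have "\<xi> \<in> Ext1_with C A B (rep c)"
    using tr(1) xi by (auto simp: Ext1_with_def)
  then show "\<xi> \<in> (\<Union>c\<in>Iso C. Ext1_with C A B (rep c))"
    using c(1) by blast
qed (auto simp: Ext1_with_def)

text \<open>Each coefficient is the proportion of extension classes with the given middle term, and
  the middle terms partition all of \<open>Ext1 C A B\<close>.\<close>

lemma Sum_any_comult_coeff:
  assumes obj: "A \<in> objs C" "B \<in> objs C"
  shows "Sum_any (\<lambda>c. if c \<in> Iso C then comult_coeff C A B (rep c) else 0) = 1"
proof -
  let ?E = "\<lambda>c. Ext1_with C A B (rep c)"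
  let ?I = "{c \<in> Iso C. ?E c \<noteq> {}}"
  have fin: "finite (Ext1 C A B)"
    using finite_Ext1 obj by simp
  have finE: "finite (?E c)" for c
    using fin by (simp add: Ext1_with_def)
  have disj: "c = d" if "c \<in> ?I" "d \<in> ?I" "\<xi> \<in> ?E c" "\<xi> \<in> ?E d" for c d \<xi>
    using that Ext1_with_middle_unique rep_isomorphic_imp_eq by blast
  \<comment> \<open>\<open>Sum_any\<close> would return 0 on an infinite support, so finiteness has
    to be shown: the middle terms that occur own disjoint nonempty subsets of the finite set
    \<open>Ext1 C A B\<close>.\<close>
  have "inj_on ?E ?I"
    using disj by (intro inj_onI) blast
  moreover have "?E ` ?I \<subseteq> Pow (Ext1 C A B)"
    by (auto simp: Ext1_with_def)
  ultimately have finI: "finite ?I"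
    using fin by (meson finite_Pow_iff finite_imageD finite_subset)
  have coeff: "comult_coeff C A B (rep c) = of_nat (card (?E c)) / of_nat (card (Ext1 C A B))"
    if "c \<in> Iso C" for c
    using comult_coeff_eq[OF obj rep_Iso(2)[OF that]] .
  have "Sum_any (\<lambda>c. if c \<in> Iso C then comult_coeff C A B (rep c) else 0) =
      (\<Sum>c\<in>?I. if c \<in> Iso C then comult_coeff C A B (rep c) else 0)"
    using coeff by (intro Sum_any.expand_superset[OF finI]) auto
  also have "\<dots> = (\<Sum>c\<in>?I. of_nat (card (?E c)) / of_nat (card (Ext1 C A B)))"
    using coeff by (intro sum.cong) auto
  also have "\<dots> = of_nat (\<Sum>c\<in>?I. card (?E c)) / of_nat (card (Ext1 C A B))"
    by (simp add: sum_divide_distrib)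
  also have "(\<Sum>c\<in>?I. card (?E c)) = card (\<Union>c\<in>?I. ?E c)"
    using finI finE disj by (intro card_UN_disjoint[symmetric]) blast+
  also have "(\<Union>c\<in>?I. ?E c) = Ext1 C A B"
    unfolding Ext1_eq_Union_middle_terms[of A B] by blast
  finally show ?thesis
    using fin Ext1_nonempty[OF obj] by simp
qed

lemma comult_hall_exp: "comult C (hall_exp C) = hall_tensor (hall_exp C) (hall_exp C)"
proof
  fix x :: "'o set \<times> 'o set"
  obtain a b where x: "x = (a, b)"
    by (cases x)
  show "comult C (hall_exp C) x = hall_tensor (hall_exp C) (hall_exp C) x"
  proof (cases "a \<in> Iso C \<and> b \<in> Iso C")
    case True
    then have "hall_exp C c * comult_basis C c (a, b) =
        (if c \<in> Iso C then comult_coeff C (rep a) (rep b) (rep c) else 0)" for c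
      by (simp add: hall_exp_def comult_basis_def)
    then show ?thesis
      using True Sum_any_comult_coeff rep_Iso(2)
      by (simp add: x comult_def hall_tensor_def hall_exp_def)
  next
    \<comment> \<open>Off \<open>Iso C\<close> both sides take their default value: every
      \<open>comult_basis C c x\<close> is 0, and so is one factor of the tensor.\<close>
    case False
    then show ?thesis
      by (auto simp: x comult_def hall_tensor_def hall_exp_def comult_basis_def)
  qed
qed

end

theorem lemma1p2:
  fixes C :: "('o, 'm) preadd_cat"
  assumes "finitary_abelian_category C"
  shows "comult C (hall_exp C) = hall_tensor (hall_exp C) (hall_exp C)"
  using assms by (rule finitary_abelian_category.comult_hall_exp)

end
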